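(* Let $n\ge1$ and $\mu>2$. There are constants $C_1,C_2>0$ depending on $n$ and $\mu$ such that the following holds. Let $u_0\in H^1({\bf R}^n)\cap L^1({\bf R}^n)$ and $u_1\in L^2({\bf R}^n)\cap L^{1,1}({\bf R}^n)$, let $P_1:=\int_{{\bf R}^n}u_1(x)\,dx$, and let $u(t,x)$ be the solution of $$u_{tt}-\Delta u+\mu L u_t=0\ \text{ in }(0,\infty)\times{\bf R}^n,\qquad u(0,x)=u_0(x),\quad u_t(0,x)=u_1(x),\ x\in{\bf R}^n.$$ Then, for all sufficiently large $t$, $$C_1|P_1|\,t^{1-\frac n2}\le\Vert u(t,\cdot)\Vert\le C_2\big(\Vert u_0\Vert+\Vert u_0\Vert_1+\Vert u_1\Vert+\Vert u_1\Vert_{1,1}\big)t^{1-\frac n2}.$$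
   Context: Fourier transform: ${\cal F}_{x\to\xi}(f)(\xi)=\hat f(\xi)=\int_{{\bf R}^n}e^{-ix\cdot\xi}f(x)\,dx$, with inverse ${\cal F}^{-1}_{\xi\to x}$. The operator $L=\log(I+(-\Delta)^{1/2})$ on $L^2({\bf R}^n)$ is the Fourier multiplier $(Lf)(x)={\cal F}^{-1}_{\xi\to x}(\log(1+|\xi|)\hat f(\xi))(x)$ with domain $D(L)=\{f\in L^2:\int(1+\log^2(1+|\xi|))|\hat f(\xi)|^2d\xi<\infty\}$. For $(u_0,u_1)\in H^1({\bf R}^n)\times L^2({\bf R}^n)$ "the solution" is the unique mild solution $u\in C([0,\infty);H^1({\bf R}^n))\cap C^1([0,\infty);L^2({\bf R}^n))$; equivalently, $w(t,\xi)=\hat u(t,\xi)$ (Fourier transform in $x$) solves $w_{tt}+\mu\log(1+|\xi|)w_t+|\xi|^2w=0$, $w(0,\xi)=\hat u_0(\xi)$, $w_t(0,\xi)=\hat u_1(\xi)$. Norms: $\Vert\cdot\Vert_q$ is the $L^q({\bf R}^n)$-norm, $\Vert\cdot\Vert=\Vert\cdot\Vert_2$, and $L^{1,1}({\bf R}^n)=\{f\in L^1:\Vert f\Vert_{1,1}:=\int_{{\bf R}^n}(1+|x|)|f(x)|dx<\infty\}$. "Sufficiently large $t$" means $t\ge t_0$ for some $t_0>0$, which may depend on the data. *)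

theory Defs
  imports "HOL-Analysis.Analysis"
begin

text \<open>
  Function spaces on Euclidean space are represented by sets of complex-valued Borel functions;
  every Lebesgue class has such a representative, and equality of classes is
  equality \<open>lborel\<close>-almost everywhere.
\<close>

definition L1_space :: "('a::euclidean_space \<Rightarrow> complex) set" where
  "L1_space = {f. integrable lborel f}"

definition norm_L1 :: "('a::euclidean_space \<Rightarrow> complex) \<Rightarrow> real" where
  "norm_L1 f = (LINT x|lborel. cmod (f x))"

definition L11_space :: "('a::euclidean_space \<Rightarrow> complex) set" where
  "L11_space = {f \<in> L1_space. integrable lborel (\<lambda>x. (1 + norm x) * cmod (f x))}"

definition norm_L11 :: "('a::euclidean_space \<Rightarrow> complex) \<Rightarrow> real" where
  "norm_L11 f = (LINT x|lborel. (1 + norm x) * cmod (f x))"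

definition L2_space :: "('a::euclidean_space \<Rightarrow> complex) set" where
  "L2_space = {f \<in> borel_measurable lborel. integrable lborel (\<lambda>x. (cmod (f x))\<^sup>2)}"

definition norm_L2 :: "('a::euclidean_space \<Rightarrow> complex) \<Rightarrow> real" where
  "norm_L2 f = sqrt (LINT x|lborel. (cmod (f x))\<^sup>2)"

definition fourier :: "('a::euclidean_space \<Rightarrow> complex) \<Rightarrow> 'a \<Rightarrow> complex" where
  "fourier f \<xi> = (LINT x|lborel. exp (- \<i> * complex_of_real (x \<bullet> \<xi>)) * f x)"

text \<open>
  The Fourier--Plancherel transform: \<open>g\<close> is (a representative of) the transform of \<open>f\<close> if the
  transforms of the truncations of \<open>f\<close> to balls, which are integrable, converge to \<open>g\<close> in the
  mean square.  The extended integral avoids the convention that a divergent Bochner integral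
  is zero.
\<close>

definition has_L2_fourier ::
    "('a::euclidean_space \<Rightarrow> complex) \<Rightarrow> ('a \<Rightarrow> complex) \<Rightarrow> bool" where
  "has_L2_fourier f g \<longleftrightarrow> f \<in> L2_space \<and> g \<in> L2_space \<and>
     ((\<lambda>R. \<integral>\<^sup>+ \<xi>. ennreal ((cmod (fourier (\<lambda>x. if norm x \<le> R then f x else 0) \<xi> - g \<xi>))\<^sup>2)
        \<partial>lborel) \<longlongrightarrow> 0) at_top"

definition L2_fourier :: "('a::euclidean_space \<Rightarrow> complex) \<Rightarrow> 'a \<Rightarrow> complex" where
  "L2_fourier f = (SOME g. has_L2_fourier f g)"

definition H1_space :: "('a::euclidean_space \<Rightarrow> complex) set" where
  "H1_space = {f. \<exists>g. has_L2_fourier f g \<and>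
     integrable lborel (\<lambda>\<xi>. (1 + (norm \<xi>)\<^sup>2) * (cmod (g \<xi>))\<^sup>2)}"

definition norm_H1 :: "('a::euclidean_space \<Rightarrow> complex) \<Rightarrow> real" where
  "norm_H1 f = sqrt (LINT \<xi>|lborel. (1 + (norm \<xi>)\<^sup>2) * (cmod (L2_fourier f \<xi>))\<^sup>2)"

definition continuous_into_H1 :: "(real \<Rightarrow> 'a::euclidean_space \<Rightarrow> complex) \<Rightarrow> bool" where
  "continuous_into_H1 u \<longleftrightarrow> (\<forall>t\<ge>0. u t \<in> H1_space \<and>
     ((\<lambda>s. norm_H1 (\<lambda>x. u s x - u t x)) \<longlongrightarrow> 0) (at t within {0..}))"

definition continuous_into_L2 :: "(real \<Rightarrow> 'a::euclidean_space \<Rightarrow> complex) \<Rightarrow> bool" where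
  "continuous_into_L2 v \<longleftrightarrow> (\<forall>t\<ge>0. v t \<in> L2_space \<and>
     ((\<lambda>s. norm_L2 (\<lambda>x. v s x - v t x)) \<longlongrightarrow> 0) (at t within {0..}))"

definition has_L2_time_derivative ::
    "(real \<Rightarrow> 'a::euclidean_space \<Rightarrow> complex) \<Rightarrow> (real \<Rightarrow> 'a \<Rightarrow> complex) \<Rightarrow> bool" where
  "has_L2_time_derivative u v \<longleftrightarrow> (\<forall>t\<ge>0. u t \<in> L2_space \<and> v t \<in> L2_space \<and>
     ((\<lambda>s. norm_L2 (\<lambda>x. (u s x - u t x) /\<^sub>R (s - t) - v t x)) \<longlongrightarrow> 0) (at t within {0..}))"

text \<open>The symbol of the Fourier multiplier \<open>L = log (I + (-\<Delta>)\<^bsup>1/2\<^esup>)\<close>.\<close>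

definition log_symbol :: "'a::euclidean_space \<Rightarrow> real" where
  "log_symbol \<xi> = ln (1 + norm \<xi>)"

text \<open>
  Solutions of \<open>u\<^sub>t\<^sub>t - \<Delta>u + \<mu> L u\<^sub>t = 0\<close> with \<open>u(0) = u0\<close> and \<open>u\<^sub>t(0) = u1\<close>, in the class
  \<open>C([0,\<infinity>); H\<^sup>1) \<inter> C\<^sup>1([0,\<infinity>); L\<^sup>2)\<close>.  In general \<open>u\<^sub>t(t)\<close> is not in the domain of \<open>L\<close>, so the
  equation is imposed on the spatial Fourier transform \<open>w\<close> of \<open>u\<close>, where it is an ordinary
  differential equation in \<open>t\<close> for almost every frequency.  The function \<open>w\<close> is quantified
  because the transform at each time is determined only almost everywhere.
\<close>

definition mild_solution ::
    "real \<Rightarrow> ('a::euclidean_space \<Rightarrow> complex) \<Rightarrow> ('a \<Rightarrow> complex) \<Rightarrow>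
      (real \<Rightarrow> 'a \<Rightarrow> complex) \<Rightarrow> bool" where
  "mild_solution \<mu> u0 u1 u \<longleftrightarrow>
     continuous_into_H1 u \<and>
     (\<exists>v. has_L2_time_derivative u v \<and> continuous_into_L2 v \<and>
        (AE x in lborel. u 0 x = u0 x) \<and> (AE x in lborel. v 0 x = u1 x)) \<and>
     (\<exists>w w'.
        (\<forall>t\<ge>0. has_L2_fourier (u t) (w t)) \<and>
        has_L2_fourier u0 (w 0) \<and> has_L2_fourier u1 (w' 0) \<and>
        (AE \<xi> in lborel. \<forall>t\<ge>0.
           ((\<lambda>s. w s \<xi>) has_vector_derivative w' t \<xi>) (at t within {0..}) \<and>
           ((\<lambda>s. w' s \<xi>) has_vector_derivative
              - ((\<mu> * log_symbol \<xi>) *\<^sub>R w' t \<xi> + (norm \<xi>)\<^sup>2 *\<^sub>R w t \<xi>)) (at t within {0..})))"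

end

theory Submission
  imports Defs "HOL-Probability.Probability" "HOL-Real_Asymp.Real_Asymp"
begin

text \<open>
  In the Fourier variable the equation decouples.  At a frequency \<open>\<xi>\<close> with \<open>r = \<bar>\<xi>\<bar>\<close> the transform
  solves the damped oscillator \<open>W'' + b W' + r\<^sup>2 W = 0\<close> with \<open>b = \<mu> ln (1 + r)\<close>, and by Plancherel's
  identity (\<open>plancherel_L2\<close>) it suffices to estimate the mean square of \<open>W(t)\<close> over all frequencies.

  The assumption \<open>\<mu> > 2\<close> makes low frequencies overdamped.  Since \<open>ln (1 + r)\<close> behaves like \<open>r\<close> near \<open>0\<close>,
  there \<open>b \<ge> \<kappa> r\<close> for some \<open>\<kappa> > 2\<close>, so the characteristic roots \<open>q < p < 0\<close> are real, and
  \<open>-p\<close>, \<open>-q\<close> and \<open>p - q\<close> are all comparable to \<open>r\<close>.  The response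
  \<open>(exp (p t) - exp (q t)) / (p - q)\<close> to the initial velocity is at most \<open>t exp (- r t / \<mu>)\<close> and, where
  \<open>r t \<le> 1\<close>, at least \<open>exp (- \<mu>) t\<close>; the response to the initial position has no factor \<open>t\<close>
  (\<open>overdamped_bounds\<close>).  Away from \<open>0\<close> the damping is bounded below and a perturbed energy decays
  exponentially (\<open>damped_oscillator_decay\<close>).

  For the upper bound, the low-frequency majorant \<open>t exp (- r t / \<mu>)\<close> has by scaling a mean square
  proportional to \<open>t\<^sup>2 / t\<^sup>n\<close>, which is the square of the claimed rate, and the
  remaining frequencies are exponentially small.

  For the lower bound, the ball \<open>\<bar>\<xi>\<bar> \<le> 1 / t\<close> is enough.  Its volume is proportional to \<open>1 / t\<^sup>n\<close>, and on it
  the transform of \<open>u\<^sub>1\<close> differs from its value \<open>P\<^sub>1\<close> at \<open>0\<close> by at most \<open>\<parallel>u\<^sub>1\<parallel>\<^sub>1\<^sub>,\<^sub>1 / t\<close>.  Hence \<open>\<bar>W(t)\<bar>\<close> is at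
  least \<open>exp (- \<mu>) t \<bar>P\<^sub>1\<bar>\<close> up to an error bounded in \<open>t\<close>, and when \<open>P\<^sub>1 \<noteq> 0\<close> this error is absorbed as
  soon as \<open>t\<close> is large compared with the data divided by \<open>\<bar>P\<^sub>1\<bar>\<close>.

  Plancherel's identity is proved by Gaussian regularisation.  The function \<open>\<bar>fourier f\<bar>\<^sup>2\<close> is the
  transform of the autocorrelation of \<open>f\<close>, so its integral against a wide Gaussian equals the integral of
  the autocorrelation against a concentrated one, which tends to a multiple of the value at \<open>0\<close>, that is,
  of the mean square of \<open>f\<close>.  This works for bounded integrable \<open>f\<close>; truncating the values and then the
  support gives the general case.
\<close>

section \<open>Affine substitutions and products\<close>

lemma nn_integral_lborel_affine:
  fixes f :: "'a::euclidean_space \<Rightarrow> ennreal"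
  assumes [measurable]: "f \<in> borel_measurable borel" and c: "c \<noteq> 0"
  shows "(\<integral>\<^sup>+x. f x \<partial>lborel) = ennreal (\<bar>c\<bar> ^ DIM('a)) * (\<integral>\<^sup>+x. f (a + c *\<^sub>R x) \<partial>lborel)"
  by (subst lborel_affine[OF c, of a])
     (simp add: nn_integral_density nn_integral_distr nn_integral_cmult)

lemma integral_lborel_affine:
  fixes f :: "'a::euclidean_space \<Rightarrow> 'b::{banach, second_countable_topology}"
  assumes [measurable]: "f \<in> borel_measurable borel" and c: "c \<noteq> 0"
  shows "(LINT x|lborel. f x) = \<bar>c\<bar> ^ DIM('a) *\<^sub>R (LINT x|lborel. f (a + c *\<^sub>R x))"
  by (subst lborel_affine[OF c, of a])
     (simp add: integral_density integral_distr)

lemma integrable_lborel_affine: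
  fixes f :: "'a::euclidean_space \<Rightarrow> 'b::{banach, second_countable_topology}"
  assumes f: "integrable lborel f" and c: "c \<noteq> 0"
  shows "integrable lborel (\<lambda>x. f (a + c *\<^sub>R x))"
proof -
  have [measurable]: "f \<in> borel_measurable borel" using f by auto
  have "(\<integral>\<^sup>+x. norm (f (a + c *\<^sub>R x)) \<partial>lborel) < \<infinity>"
    using f c nn_integral_lborel_affine[of "\<lambda>x. ennreal (norm (f x))" c a]
    by (auto simp: integrable_iff_bounded ennreal_mult_less_top)
  then show ?thesis by (auto simp: integrable_iff_bounded)
qed

lemma
  fixes g :: "'a::euclidean_space \<Rightarrow> real \<Rightarrow> complex"
  assumes g: "\<And>b. b \<in> Basis \<Longrightarrow> integrable lborel (g b)"
  shows integrable_lborel_prod: "integrable lborel (\<lambda>x. \<Prod>b\<in>Basis. g b (x \<bullet> b))"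
    and integral_lborel_prod: "(LINT x|lborel. (\<Prod>b\<in>Basis. g b (x \<bullet> b))) = (\<Prod>b\<in>Basis. (LINT s|lborel. g b s))"
proof -
  interpret product_sigma_finite "\<lambda>_::'a. lborel :: real measure" ..
  have [measurable]: "g b \<in> borel_measurable borel" if "b \<in> Basis" for b using g[OF that] by auto
  have eq: "(\<Prod>b\<in>Basis. g b ((\<Sum>c\<in>Basis. f c *\<^sub>R c) \<bullet> b)) = (\<Prod>b\<in>Basis. g b (f b))" for f :: "'a \<Rightarrow> real"
    by (intro prod.cong refl) simp
  show "integrable lborel (\<lambda>x. \<Prod>b\<in>Basis. g b (x \<bullet> b))"
    by (subst lborel_eq, subst integrable_distr_eq)
       (auto simp: eq intro!: product_integrable_prod g)
  show "(LINT x|lborel. (\<Prod>b\<in>Basis. g b (x \<bullet> b))) = (\<Prod>b\<in>Basis. (LINT s|lborel. g b s))"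
    by (subst lborel_eq, subst integral_distr)
       (auto simp: eq intro!: product_integral_prod g)
qed

section \<open>The Gaussian and its transform\<close>

lemma integrable_gaussian_1d: "integrable lborel (\<lambda>s::real. complex_of_real (exp (- s\<^sup>2 / 2)))"
proof -
  have "integrable lborel (\<lambda>s. sqrt (2 * pi) * std_normal_density s)"
    using integrable_normal_density[of 1 0] by (intro integrable_mult_right) auto
  then have "integrable lborel (\<lambda>s. exp (- s\<^sup>2 / 2) :: real)"
    by (simp add: std_normal_density_def)
  then show ?thesis by (rule integrable_of_real)
qed

lemma integral_gaussian_1d:
  "(LINT s|lborel. exp (- \<i> * complex_of_real (x * s)) * complex_of_real (exp (- s\<^sup>2 / 2)))
     = complex_of_real (sqrt (2 * pi) * exp (- x\<^sup>2 / 2))"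
proof -
  have "char std_normal_distribution (- x) = complex_of_real (exp (- x\<^sup>2 / 2))"
    by (simp add: char_std_normal_distribution)
  moreover have "char std_normal_distribution (- x)
      = (LINT s|lborel. std_normal_density s *\<^sub>R exp (- \<i> * complex_of_real (x * s)))"
    unfolding char_def by (subst integral_density) auto
  moreover have "(LINT s|lborel. exp (- \<i> * complex_of_real (x * s)) * complex_of_real (exp (- s\<^sup>2 / 2)))
     = (LINT s|lborel. complex_of_real (sqrt (2 * pi)) * (std_normal_density s *\<^sub>R exp (- \<i> * complex_of_real (x * s))))"
    by (intro Bochner_Integration.integral_cong refl)
       (simp add: std_normal_density_def scaleR_conv_of_real)
  moreover have "\<dots> = complex_of_real (sqrt (2 * pi))
      * (LINT s|lborel. std_normal_density s *\<^sub>R exp (- \<i> * complex_of_real (x * s)))"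
    by (rule integral_mult_right_zero)
  ultimately show ?thesis
    by (simp only: of_real_mult)
qed

definition gauss :: "'a::euclidean_space \<Rightarrow> real" where
  "gauss x = exp (- (norm x)\<^sup>2 / 2)"

lemma gauss_measurable[measurable]: "gauss \<in> borel_measurable borel"
  unfolding gauss_def[abs_def] by measurable

lemma gauss_pos: "gauss x > 0" and gauss_0: "gauss 0 = 1"
  by (simp_all add: gauss_def)

lemma gauss_prod: "gauss x = (\<Prod>b\<in>Basis. exp (- (x \<bullet> b)\<^sup>2 / 2))"
proof -
  have "(norm x)\<^sup>2 = (\<Sum>b\<in>Basis. (x \<bullet> b)\<^sup>2)"
    unfolding power2_norm_eq_inner by (subst euclidean_inner) (simp add: power2_eq_square)
  then show ?thesis
    by (simp add: gauss_def exp_sum[symmetric] sum_negf sum_divide_distrib)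
qed

lemma integrable_gauss: "integrable lborel (\<lambda>x::'a::euclidean_space. complex_of_real (gauss x))"
  using integrable_lborel_prod[of "\<lambda>_::'a. \<lambda>s. complex_of_real (exp (- s\<^sup>2 / 2))"]
    integrable_gaussian_1d
  by (simp add: gauss_prod)

lemma fourier_gauss:
  fixes x :: "'a::euclidean_space"
  shows "fourier (\<lambda>\<xi>. complex_of_real (gauss \<xi>)) x
     = complex_of_real (sqrt (2 * pi) ^ DIM('a) * gauss x)"
proof -
  have "exp (- \<i> * complex_of_real (\<xi> \<bullet> x)) * complex_of_real (gauss \<xi>)
     = (\<Prod>b\<in>Basis. exp (- \<i> * complex_of_real ((x \<bullet> b) * (\<xi> \<bullet> b)))
          * complex_of_real (exp (- (\<xi> \<bullet> b)\<^sup>2 / 2)))" for \<xi>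
  proof -
    have "- \<i> * complex_of_real (\<xi> \<bullet> x) = (\<Sum>b\<in>Basis. - \<i> * complex_of_real ((x \<bullet> b) * (\<xi> \<bullet> b)))"
      by (subst euclidean_inner) (simp add: sum_distrib_left sum_negf mult.commute)
    then show ?thesis
      by (simp add: prod.distrib gauss_prod exp_sum del: mult_minus_left)
  qed
  then have "fourier (\<lambda>\<xi>. complex_of_real (gauss \<xi>)) x
     = (LINT \<xi>|lborel. (\<Prod>b\<in>Basis. exp (- \<i> * complex_of_real ((x \<bullet> b) * (\<xi> \<bullet> b)))
          * complex_of_real (exp (- (\<xi> \<bullet> b)\<^sup>2 / 2))))"
    unfolding fourier_def by simp
  also have "\<dots> = (\<Prod>b\<in>(Basis::'a set). complex_of_real (sqrt (2 * pi) * exp (- (x \<bullet> b)\<^sup>2 / 2)))"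
  proof (subst integral_lborel_prod)
    fix b :: 'a assume "b \<in> Basis"
    show "integrable lborel (\<lambda>s. exp (- \<i> * complex_of_real ((x \<bullet> b) * s)) * complex_of_real (exp (- s\<^sup>2 / 2)))"
      by (rule Bochner_Integration.integrable_bound[OF integrable_gaussian_1d])
         (auto simp: norm_mult)
  qed (simp only: integral_gaussian_1d)
  also have "\<dots> = complex_of_real (sqrt (2 * pi) ^ DIM('a) * gauss x)"
    by (simp add: gauss_prod prod.distrib)
  finally show ?thesis .
qed

lemma fourier_gauss_scaled:
  fixes x :: "'a::euclidean_space"
  assumes "e > 0"
  shows "fourier (\<lambda>\<xi>. complex_of_real (gauss (e *\<^sub>R \<xi>))) x
     = complex_of_real (sqrt (2 * pi) ^ DIM('a) * (1 / e) ^ DIM('a) * gauss ((1 / e) *\<^sub>R x))"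
proof -
  have "fourier (\<lambda>\<xi>. complex_of_real (gauss (e *\<^sub>R \<xi>))) x
      = \<bar>1 / e\<bar> ^ DIM('a) *\<^sub>R (LINT \<xi>|lborel. exp (- \<i> * complex_of_real ((0 + (1 / e) *\<^sub>R \<xi>) \<bullet> x))
          * complex_of_real (gauss (e *\<^sub>R (0 + (1 / e) *\<^sub>R \<xi>))))"
    unfolding fourier_def using assms
    by (subst integral_lborel_affine[of _ "1 / e" 0]) auto
  also have "(LINT \<xi>|lborel. exp (- \<i> * complex_of_real ((0 + (1 / e) *\<^sub>R \<xi>) \<bullet> x))
          * complex_of_real (gauss (e *\<^sub>R (0 + (1 / e) *\<^sub>R \<xi>))))
       = fourier (\<lambda>\<xi>. complex_of_real (gauss \<xi>)) ((1 / e) *\<^sub>R x)"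
    unfolding fourier_def using assms by (intro Bochner_Integration.integral_cong refl) auto
  finally show ?thesis
    unfolding fourier_gauss using assms by (simp add: scaleR_conv_of_real)
qed

lemma integrable_gauss_scaled:
  assumes "e > 0"
  shows "integrable lborel (\<lambda>x::'a::euclidean_space. complex_of_real (gauss (e *\<^sub>R x)))"
  using integrable_lborel_affine[OF integrable_gauss, of e 0] assms by simp

lemma integral_gauss: "(LINT x|lborel. gauss (x::'a::euclidean_space)) = sqrt (2 * pi) ^ DIM('a)"
proof -
  have "complex_of_real (LINT x|lborel. gauss (x::'a)) = complex_of_real (sqrt (2 * pi) ^ DIM('a))"
    using fourier_gauss[of "0::'a"] by (simp add: fourier_def gauss_0)
  then show ?thesis by (simp only: of_real_eq_iff)
qed

section \<open>Transforms of integrable functions\<close>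

text \<open>The simplifier moves the minus sign out of the exponent's factor, so both forms are rewrite rules.\<close>
lemma fourier_integrand_norm [simp]:
  "norm (exp (- \<i> * complex_of_real (x \<bullet> \<xi>)) * z) = norm z"
  "norm (exp (- (\<i> * complex_of_real (x \<bullet> \<xi>)))) = 1"
  "norm (exp (- (\<i> * complex_of_real (x \<bullet> \<xi>))) * z) = norm z"
  by (simp_all add: norm_mult)

lemma integrable_fourier_integrand:
  assumes "integrable lborel f"
  shows "integrable lborel (\<lambda>x. exp (- \<i> * complex_of_real (x \<bullet> \<xi>)) * f x)"
  using assms by (rule Bochner_Integration.integrable_bound) (use assms in auto)

lemma fourier_measurable [measurable]:
  fixes f :: "'a::euclidean_space \<Rightarrow> complex"
  assumes [measurable]: "f \<in> borel_measurable borel"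
  shows "fourier f \<in> borel_measurable borel"
  unfolding fourier_def[abs_def] by measurable

lemma norm_fourier_le:
  fixes f :: "'a::euclidean_space \<Rightarrow> complex"
  shows "norm (fourier f \<xi>) \<le> (LINT x|lborel. norm (f x))"
  unfolding fourier_def by (rule order_trans[OF integral_norm_bound]) simp

lemma fourier_diff:
  assumes "integrable lborel f" "integrable lborel g"
  shows "fourier (\<lambda>x. f x - g x) \<xi> = fourier f \<xi> - fourier g \<xi>"
  unfolding fourier_def
  by (simp add: right_diff_distrib Bochner_Integration.integral_diff integrable_fourier_integrand[OF assms(1), simplified]
       integrable_fourier_integrand[OF assms(2), simplified])

lemma fourier_multiplication_formula:
  fixes f g :: "'a::euclidean_space \<Rightarrow> complex"
  assumes f: "integrable lborel f" and g: "integrable lborel g"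
  shows "(LINT \<xi>|lborel. fourier f \<xi> * g \<xi>) = (LINT x|lborel. f x * fourier g x)"
proof -
  have [measurable]: "f \<in> borel_measurable borel" "g \<in> borel_measurable borel" using f g by auto
  let ?F = "\<lambda>(x, \<xi>). exp (- \<i> * complex_of_real (x \<bullet> \<xi>)) * f x * g \<xi>"
  have int: "integrable (lborel \<Otimes>\<^sub>M lborel) ?F"
  proof (rule lborel_pair.Fubini_integrable)
    show "?F \<in> borel_measurable (lborel \<Otimes>\<^sub>M lborel)" by measurable
    show "integrable lborel (\<lambda>x. LINT \<xi>|lborel. norm (?F (x, \<xi>)))"
      using f by (simp add: norm_mult)
    show "AE x in lborel. integrable lborel (\<lambda>\<xi>. ?F (x, \<xi>))"
    proof (rule AE_I2)
      fix x
      have "integrable lborel (\<lambda>\<xi>. f x * g \<xi>)" using g by simp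
      then show "integrable lborel (\<lambda>\<xi>. ?F (x, \<xi>))"
        by (rule Bochner_Integration.integrable_bound) (auto simp: norm_mult)
    qed
  qed
  have "(LINT \<xi>|lborel. fourier f \<xi> * g \<xi>) = (LINT \<xi>|lborel. LINT x|lborel. ?F (x, \<xi>))"
    unfolding fourier_def by simp
  also have "\<dots> = (LINT x|lborel. LINT \<xi>|lborel. ?F (x, \<xi>))"
    using lborel_pair.Fubini_integral[OF int] by simp
  also have "\<dots> = (LINT x|lborel. f x * fourier g x)"
  proof (intro Bochner_Integration.integral_cong refl)
    fix x
    have "(LINT \<xi>|lborel. ?F (x, \<xi>)) = (LINT \<xi>|lborel. f x * (exp (- \<i> * complex_of_real (\<xi> \<bullet> x)) * g \<xi>))"
      by (simp add: inner_commute mult_ac)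
    then show "(LINT \<xi>|lborel. ?F (x, \<xi>)) = f x * fourier g x"
      unfolding fourier_def by simp
  qed
  finally show ?thesis .
qed

section \<open>Continuity of translation in the mean\<close>

text \<open>
  The displacements are a sequence because dominated convergence is a statement about sequences.
\<close>
definition translation_defect ::
    "(nat \<Rightarrow> 'a::euclidean_space) \<Rightarrow> ('a \<Rightarrow> complex) \<Rightarrow> nat \<Rightarrow> real" where
  "translation_defect z f k = (LINT x|lborel. norm (f (x + z k) - f x))"

lemma integrable_translate:
  fixes f :: "'a::euclidean_space \<Rightarrow> 'b::{banach, second_countable_topology}"
  shows "integrable lborel f \<Longrightarrow> integrable lborel (\<lambda>x. f (x + z))"
  using integrable_lborel_affine[of f 1 z] by (simp add: add.commute)

lemma integral_translate:
  fixes f :: "'a::euclidean_space \<Rightarrow> 'b::{banach, second_countable_topology}"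
  shows "f \<in> borel_measurable borel \<Longrightarrow> (LINT x|lborel. f (x + z)) = (LINT x|lborel. f x)"
  using integral_lborel_affine[of f 1 z] by (simp add: add.commute)

text \<open>
  Translation is an isometry of \<open>L\<^sup>1\<close>, so replacing \<open>f\<close> by \<open>g\<close> changes every defect by at most twice the
  distance between \<open>f\<close> and \<open>g\<close>.  The functions with vanishing defect are therefore closed in \<open>L\<^sup>1\<close>.
\<close>
lemma translation_defect_approx:
  assumes f: "integrable lborel f"
    and appr: "\<And>e. e > 0 \<Longrightarrow> \<exists>g. integrable lborel g \<and> translation_defect z g \<longlonglongrightarrow> 0 \<and>
                 (LINT x|lborel. norm (f x - g x)) \<le> e"
  shows "translation_defect z f \<longlonglongrightarrow> 0"
proof (rule LIMSEQ_I)
  fix e :: real assume "e > 0"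
  then obtain g where g: "integrable lborel g" and lim: "translation_defect z g \<longlonglongrightarrow> 0"
    and le: "(LINT x|lborel. norm (f x - g x)) \<le> e / 4"
    using appr[of "e / 4"] by auto
  have [measurable]: "f \<in> borel_measurable borel" "g \<in> borel_measurable borel" using f g by auto
  have fg: "integrable lborel (\<lambda>x. norm (f x - g x))" using f g by simp
  have bound: "translation_defect z f k \<le> translation_defect z g k + e / 2" for k
  proof -
    have "translation_defect z f k
        \<le> (LINT x|lborel. norm (f (x + z k) - g (x + z k)) + norm (g (x + z k) - g x) + norm (f x - g x))"
      unfolding translation_defect_def
    proof (rule integral_mono)
      show "norm (f (x + z k) - f x)
          \<le> norm (f (x + z k) - g (x + z k)) + norm (g (x + z k) - g x) + norm (f x - g x)" for x
        by norm
    qed (use f g integrable_translate[OF f] integrable_translate[OF g] in auto)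
    also have "\<dots> = (LINT x|lborel. norm (f x - g x)) + translation_defect z g k + (LINT x|lborel. norm (f x - g x))"
      unfolding translation_defect_def
      using f g integrable_translate[OF f] integrable_translate[OF g]
        integral_translate[of "\<lambda>x. norm (f x - g x)" "z k"] by simp
    finally show ?thesis using le by linarith
  qed
  from lim \<open>e > 0\<close> obtain N where N: "\<And>k. k \<ge> N \<Longrightarrow> norm (translation_defect z g k) < e / 2"
    using LIMSEQ_D[of "translation_defect z g" 0 "e / 2"] by auto
  show "\<exists>N. \<forall>k\<ge>N. norm (translation_defect z f k - 0) < e"
  proof (intro exI allI impI)
    fix k assume "k \<ge> N"
    have "0 \<le> translation_defect z f k" by (simp add: translation_defect_def)
    then show "norm (translation_defect z f k - 0) < e"
      using bound[of k] N[OF \<open>k \<ge> N\<close>] by simp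
  qed
qed

text \<open>
  Openness is what makes this elementary: a point of \<open>U\<close> stays in \<open>U\<close> under small displacements, so the
  part of \<open>U\<close> that leaves \<open>U\<close> has small measure by dominated convergence.  The part that enters has the
  same measure, by translation invariance.
\<close>
lemma translation_defect_open:
  fixes U :: "'a::euclidean_space set"
  assumes U: "open U" "emeasure lborel U < \<infinity>" and z: "z \<longlonglongrightarrow> 0"
  shows "translation_defect z (\<lambda>x. indicator U x *\<^sub>R c) \<longlonglongrightarrow> 0"
proof -
  have [measurable]: "U \<in> sets borel" using U by simp
  have int: "integrable lborel (indicator U :: 'a \<Rightarrow> real)" using U by simp
  define J where "J k = (LINT x|lborel. indicator U x * (1 - indicator U (x + z k)) :: real)" for k
  have "J \<longlonglongrightarrow> (LINT x::'a|lborel. 0)"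
    unfolding J_def
  proof (rule integral_dominated_convergence[OF _ _ int])
    show "AE x in lborel. (\<lambda>k. indicator U x * (1 - indicator U (x + z k)) :: real) \<longlonglongrightarrow> 0"
    proof (intro AE_I2)
      fix x :: 'a
      show "(\<lambda>k. indicator U x * (1 - indicator U (x + z k)) :: real) \<longlonglongrightarrow> 0"
      proof (cases "x \<in> U")
        case True
        have "(\<lambda>k. x + z k) \<longlonglongrightarrow> x + 0" by (intro tendsto_intros z)
        then have "\<forall>\<^sub>F k in sequentially. x + z k \<in> U"
          using topological_tendstoD[OF _ U(1)] True by simp
        then show ?thesis
          using True by (intro tendsto_eventually) (auto elim!: eventually_mono)
      qed simp
    qed
  qed (auto simp: indicator_def)
  then have lim: "(\<lambda>k. 2 * norm c * J k) \<longlonglongrightarrow> 0" using tendsto_mult_left[of J 0 sequentially "2 * norm c"] by simp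
  have eq: "translation_defect z (\<lambda>x. indicator U x *\<^sub>R c) k = 2 * norm c * J k" for k
  proof -
    let ?i = "indicator U :: 'a \<Rightarrow> real"
    have int2: "integrable lborel (\<lambda>x. ?i (x + z k))" by (rule integrable_translate[OF int])
    have int3: "integrable lborel (\<lambda>x. ?i x * ?i (x + z k))"
      by (rule Bochner_Integration.integrable_bound[OF int]) (auto simp: indicator_def)
    have "translation_defect z (\<lambda>x. indicator U x *\<^sub>R c) k
      = (LINT x|lborel. norm c * (?i x + ?i (x + z k) - 2 * (?i x * ?i (x + z k))))"
      unfolding translation_defect_def
      by (intro Bochner_Integration.integral_cong refl) (auto simp: indicator_def)
    also have "\<dots> = norm c * ((LINT x|lborel. ?i x) + (LINT x|lborel. ?i (x + z k)) - 2 * (LINT x|lborel. ?i x * ?i (x + z k)))"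
      using int int2 int3 by (simp del: integrable_indicator_iff integral_indicator)
    also have "(LINT x|lborel. ?i (x + z k)) = (LINT x|lborel. ?i x)"
      by (rule integral_translate) simp
    finally have "translation_defect z (\<lambda>x. indicator U x *\<^sub>R c) k
      = norm c * (2 * ((LINT x|lborel. ?i x) - (LINT x|lborel. ?i x * ?i (x + z k))))"
      by simp
    also have "(LINT x|lborel. ?i x) - (LINT x|lborel. ?i x * ?i (x + z k)) = J k"
      unfolding J_def right_diff_distrib
      using int int3 by (simp del: integrable_indicator_iff integral_indicator)
    finally show ?thesis by simp
  qed
  show ?thesis using lim by (rule Lim_transform_eventually) (simp add: eq)
qed

text \<open>
  Outer regularity passes from open sets to measurable ones; linearity and \<open>L\<^sup>1\<close>-limits do the rest.
\<close>
lemma translation_continuous_L1: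
  fixes f :: "'a::euclidean_space \<Rightarrow> complex"
  assumes f: "integrable lborel f" and z: "z \<longlonglongrightarrow> 0"
  shows "translation_defect z f \<longlonglongrightarrow> 0"
  using f
proof (induction rule: integrable_induct)
  case (base A c)
  show ?case
  proof (rule translation_defect_approx)
    show "integrable lborel (\<lambda>x. indicator A x *\<^sub>R c)" using base by simp
    fix e :: real assume "e > 0"
    \<comment> \<open>The summand 1 guards against division by zero when c = 0.\<close>
    define d where "d = e / (1 + norm c)"
    have "d > 0" using \<open>e > 0\<close> by (simp add: d_def add_pos_nonneg)
    from base obtain U where U: "open U" "A \<subseteq> U" "emeasure lborel (U - A) < ennreal d"
      using outer_regular_lborel[of A d] \<open>d > 0\<close> by auto
    have [measurable]: "U \<in> sets borel" "A \<in> sets borel" using U base by auto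
    have fin: "emeasure lborel (U - A) < \<infinity>" using U(3) by (rule less_trans) simp
    have "emeasure lborel U = emeasure lborel A + emeasure lborel (U - A)"
      using U(2) by (subst plus_emeasure) (auto simp: Un_absorb1)
    then have Ufin: "emeasure lborel U < \<infinity>" using base fin by (simp add: ennreal_add_less_top)
    have "(LINT x|lborel. norm (indicator A x *\<^sub>R c - indicator U x *\<^sub>R c))
        = (LINT x|lborel. norm c * indicator (U - A) x)"
      using U(2) by (intro Bochner_Integration.integral_cong refl) (auto simp: indicator_def)
    also have "\<dots> = norm c * measure lborel (U - A)" by simp
    also have "measure lborel (U - A) \<le> d"
      using U(3) \<open>d > 0\<close> by (simp add: measure_def enn2real_leI less_imp_le)
    then have "norm c * measure lborel (U - A) \<le> (1 + norm c) * d"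
      by (intro mult_mono) auto
    also have "\<dots> = e" using norm_ge_zero[of c] unfolding d_def by (simp add: add_nonneg_eq_0_iff)
    finally show "\<exists>g. integrable lborel g \<and> translation_defect z g \<longlonglongrightarrow> 0 \<and>
        (LINT x|lborel. norm (indicator A x *\<^sub>R c - g x)) \<le> e"
      using translation_defect_open[OF U(1) Ufin z, of c] Ufin
      by (intro exI[of _ "\<lambda>x. indicator U x *\<^sub>R c"]) simp
  qed
next
  case (add f g)
  have [measurable]: "f \<in> borel_measurable borel" "g \<in> borel_measurable borel" using add by auto
  note ints = add.hyps integrable_translate[OF add.hyps(1)] integrable_translate[OF add.hyps(2)]
  have le: "translation_defect z (\<lambda>x. f x + g x) k \<le> translation_defect z f k + translation_defect z g k" for k
  proof -
    have "translation_defect z (\<lambda>x. f x + g x) k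
      \<le> (LINT x|lborel. norm (f (x + z k) - f x) + norm (g (x + z k) - g x))"
      unfolding translation_defect_def
      by (rule integral_mono) (use ints norm_diff_triangle_ineq in auto)
    then show ?thesis unfolding translation_defect_def using ints by simp
  qed
  have lim: "(\<lambda>k. translation_defect z f k + translation_defect z g k) \<longlonglongrightarrow> 0"
    using tendsto_add[OF add.IH] by simp
  have nonneg: "0 \<le> translation_defect z h k" for h k by (simp add: translation_defect_def)
  show ?case
    by (rule tendsto_sandwich[OF _ _ tendsto_const lim]) (simp_all add: le nonneg)
next
  case (lim f s)
  show ?case
  proof (rule translation_defect_approx[OF lim.hyps(4)])
    fix e :: real assume "e > 0"
    have [measurable]: "f \<in> borel_measurable borel" "s i \<in> borel_measurable borel" for i
      using lim.hyps(1,4) by auto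
    have "(\<lambda>i. LINT x|lborel. norm (f x - s i x)) \<longlonglongrightarrow> (LINT x::'a|lborel. 0)"
    proof (rule integral_dominated_convergence[where w = "\<lambda>x. 3 * norm (f x)"])
      show "AE x in lborel. (\<lambda>i. norm (f x - s i x)) \<longlonglongrightarrow> 0"
      proof (rule AE_I2)
        fix x :: 'a
        have "(\<lambda>i. norm (f x - s i x)) \<longlonglongrightarrow> norm (f x - f x)"
          using lim.hyps(2)[of x] by (intro tendsto_intros) auto
        then show "(\<lambda>i. norm (f x - s i x)) \<longlonglongrightarrow> 0" by simp
      qed
      show "AE x in lborel. norm (norm (f x - s i x)) \<le> 3 * norm (f x)" for i
      proof (rule AE_I2)
        fix x
        show "norm (norm (f x - s i x)) \<le> 3 * norm (f x)"
          using lim.hyps(3)[of x i] norm_triangle_ineq4[of "f x" "s i x"] by simp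
      qed
    qed (use lim in auto)
    then obtain i where "norm ((LINT x|lborel. norm (f x - s i x)) - 0) < e"
      using LIMSEQ_D[OF _ \<open>e > 0\<close>] by fastforce
    then show "\<exists>g. integrable lborel g \<and> translation_defect z g \<longlonglongrightarrow> 0 \<and> (LINT x|lborel. norm (f x - g x)) \<le> e"
      using lim.hyps(1) lim.IH by (intro exI[of _ "s i"]) auto
  qed
qed

section \<open>Plancherel's identity\<close>

lemma cnj_borel_measurable [measurable]: "cnj \<in> borel_measurable borel"
  by (intro borel_measurable_continuous_onI continuous_intros)

definition autocorrelation :: "('a::euclidean_space \<Rightarrow> complex) \<Rightarrow> 'a \<Rightarrow> complex" where
  "autocorrelation f z = (LINT x|lborel. f (x + z) * cnj (f x))"

text \<open>
  The autocorrelation is the convolution of \<open>f\<close> with the conjugate of its reflection, and the transforms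
  of these two factors are conjugate to each other.  Both claims are Fubini's theorem for \<open>f (x + z) cnj (f x)\<close>.
\<close>
lemma
  fixes f :: "'a::euclidean_space \<Rightarrow> complex"
  assumes f: "integrable lborel f"
  shows integrable_autocorrelation: "integrable lborel (autocorrelation f)"
    and fourier_autocorrelation: "fourier (autocorrelation f) \<xi> = complex_of_real ((norm (fourier f \<xi>))\<^sup>2)"
proof -
  have [measurable]: "f \<in> borel_measurable borel" using f by auto
  let ?F = "\<lambda>(x, z). f (x + z) * cnj (f x)"
  let ?G = "\<lambda>(x, z). exp (- \<i> * complex_of_real (z \<bullet> \<xi>)) * (f (x + z) * cnj (f x))"
  have trans: "integrable lborel (\<lambda>z. f (x + z))" for x
    using integrable_translate[OF f, of x] by (simp add: add.commute)
  have trans': "(LINT z|lborel. g (x + z)) = (LINT z|lborel. g z)" if "g \<in> borel_measurable borel"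
    for g :: "'a \<Rightarrow> complex" and x
    using integral_translate[OF that, of x] by (simp add: add.commute)
  have int: "integrable (lborel \<Otimes>\<^sub>M lborel) ?F"
  proof (rule lborel_pair.Fubini_integrable)
    have "(LINT z|lborel. norm (f (x + z))) = (LINT z|lborel. norm (f z))" for x
      using integral_translate[of "\<lambda>z. norm (f z)" x] by (simp add: add.commute)
    then show "integrable lborel (\<lambda>x. LINT z|lborel. norm (?F (x, z)))"
      using f by (simp add: norm_mult)
    show "AE x in lborel. integrable lborel (\<lambda>z. ?F (x, z))"
      using trans by simp
    show "?F \<in> borel_measurable (lborel \<Otimes>\<^sub>M lborel)" by measurable
  qed
  have "integrable lborel (\<lambda>z. LINT x|lborel. ?F (x, z))"
    using lborel_pair.integrable_snd[OF int] by simp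
  then show "integrable lborel (autocorrelation f)"
    by (simp add: autocorrelation_def[abs_def])
  have intG: "integrable (lborel \<Otimes>\<^sub>M lborel) ?G"
    by (rule Bochner_Integration.integrable_bound[OF int]) (auto simp: split_beta)
  have "fourier (autocorrelation f) \<xi> = (LINT z|lborel. LINT x|lborel. ?G (x, z))"
    unfolding fourier_def autocorrelation_def by simp
  also have "\<dots> = (LINT x|lborel. LINT z|lborel. ?G (x, z))"
    using lborel_pair.Fubini_integral[OF intG] by simp
  also have "\<dots> = (LINT x|lborel. cnj (exp (- \<i> * complex_of_real (x \<bullet> \<xi>)) * f x) * fourier f \<xi>)"
  proof (intro Bochner_Integration.integral_cong refl)
    fix x
    have "(LINT z|lborel. ?G (x, z))
        = (LINT z|lborel. cnj (exp (- \<i> * complex_of_real (x \<bullet> \<xi>)) * f x)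
            * (exp (- \<i> * complex_of_real ((x + z) \<bullet> \<xi>)) * f (x + z)))"
    proof (intro Bochner_Integration.integral_cong refl)
      fix z
      have "exp (- \<i> * complex_of_real (z \<bullet> \<xi>))
          = cnj (exp (- \<i> * complex_of_real (x \<bullet> \<xi>))) * exp (- \<i> * complex_of_real ((x + z) \<bullet> \<xi>))"
        by (simp add: exp_cnj exp_add[symmetric] inner_add_left algebra_simps)
      then show "?G (x, z) = cnj (exp (- \<i> * complex_of_real (x \<bullet> \<xi>)) * f x)
            * (exp (- \<i> * complex_of_real ((x + z) \<bullet> \<xi>)) * f (x + z))"
        by (simp only: complex_cnj_mult prod.case) (simp only: mult_ac)
    qed
    also have "\<dots> = cnj (exp (- \<i> * complex_of_real (x \<bullet> \<xi>)) * f x)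
        * (LINT z|lborel. exp (- \<i> * complex_of_real ((x + z) \<bullet> \<xi>)) * f (x + z))"
      by (rule integral_mult_right_zero)
    also have "(LINT z|lborel. exp (- \<i> * complex_of_real ((x + z) \<bullet> \<xi>)) * f (x + z)) = fourier f \<xi>"
      unfolding fourier_def
      using trans'[of "\<lambda>z. exp (- \<i> * complex_of_real (z \<bullet> \<xi>)) * f z" x] by simp
    finally show "(LINT z|lborel. ?G (x, z))
        = cnj (exp (- \<i> * complex_of_real (x \<bullet> \<xi>)) * f x) * fourier f \<xi>" .
  qed
  also have "\<dots> = (LINT x|lborel. cnj (exp (- \<i> * complex_of_real (x \<bullet> \<xi>)) * f x)) * fourier f \<xi>"
    by (rule integral_mult_left_zero)
  also have "(LINT x|lborel. cnj (exp (- \<i> * complex_of_real (x \<bullet> \<xi>)) * f x)) = cnj (fourier f \<xi>)"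
    unfolding fourier_def by (rule Bochner_Integration.integral_cnj)
  also have "cnj (fourier f \<xi>) * fourier f \<xi> = complex_of_real ((norm (fourier f \<xi>))\<^sup>2)"
    by (simp only: complex_norm_square mult.commute)
  finally show "fourier (autocorrelation f) \<xi> = complex_of_real ((norm (fourier f \<xi>))\<^sup>2)" .
qed

text \<open>
  Boundedness of \<open>f\<close> reduces continuity of the autocorrelation at \<open>0\<close>, which for a general square-integrable
  function amounts to continuity of translation in \<open>L\<^sup>2\<close>, to continuity of translation in \<open>L\<^sup>1\<close>.
\<close>
lemma autocorrelation_diff_le:
  fixes f :: "'a::euclidean_space \<Rightarrow> complex"
  assumes f: "integrable lborel f" and M: "\<And>x. norm (f x) \<le> M"
  shows "norm (autocorrelation f z - autocorrelation f 0) \<le> M * (LINT x|lborel. norm (f (x + z) - f x))"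
proof -
  have [measurable]: "f \<in> borel_measurable borel" using f by auto
  note fz = integrable_translate[OF f]
  have int: "integrable lborel (\<lambda>x. f (x + z) * cnj (f x))" for z
  proof (rule Bochner_Integration.integrable_bound)
    show "integrable lborel (\<lambda>x. norm (f (x + z)) * M)" using fz by simp
    show "AE x in lborel. norm (f (x + z) * cnj (f x)) \<le> norm (norm (f (x + z)) * M)"
      using order_trans[OF M abs_ge_self] by (auto simp: norm_mult abs_mult intro!: mult_left_mono)
  qed simp
  have "autocorrelation f z - autocorrelation f 0 = (LINT x|lborel. (f (x + z) - f x) * cnj (f x))"
    unfolding autocorrelation_def using int[of z] int[of 0] by (simp add: left_diff_distrib)
  also have "norm \<dots> \<le> (LINT x|lborel. norm ((f (x + z) - f x) * cnj (f x)))"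
    by (rule integral_norm_bound)
  also have "\<dots> \<le> (LINT x|lborel. M * norm (f (x + z) - f x))"
  proof (rule integral_mono)
    show "integrable lborel (\<lambda>x. norm ((f (x + z) - f x) * cnj (f x)))"
      using int[of z] int[of 0] by (auto simp: left_diff_distrib intro!: Bochner_Integration.integrable_norm)
    show "norm ((f (x + z) - f x) * cnj (f x)) \<le> M * norm (f (x + z) - f x)" for x
      using M[of x] by (simp add: norm_mult mult.commute mult_right_mono)
  qed (use fz[of z] f in auto)
  finally show ?thesis by simp
qed

text \<open>
  The multiplication formula moves the transform from the autocorrelation to the Gaussian.  After the
  substitution \<open>z \<mapsto> e z\<close> the parameter \<open>e\<close> sits in the argument of the autocorrelation, which is the
  form needed for dominated convergence as \<open>e\<close> tends to \<open>0\<close>.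
\<close>
lemma gauss_weighted_plancherel:
  fixes f :: "'a::euclidean_space \<Rightarrow> complex"
  assumes f: "integrable lborel f" and e: "e > 0"
  shows "(LINT \<xi>|lborel. complex_of_real ((norm (fourier f \<xi>))\<^sup>2 * gauss (e *\<^sub>R \<xi>)))
    = complex_of_real (sqrt (2 * pi) ^ DIM('a)) * (LINT z|lborel. autocorrelation f (e *\<^sub>R z) * complex_of_real (gauss z))"
proof -
  let ?h = "autocorrelation f" and ?c = "complex_of_real (sqrt (2 * pi) ^ DIM('a))"
  note h = integrable_autocorrelation[OF f]
  have [measurable]: "?h \<in> borel_measurable borel" using h by auto
  have "(LINT \<xi>|lborel. complex_of_real ((norm (fourier f \<xi>))\<^sup>2 * gauss (e *\<^sub>R \<xi>)))
      = (LINT \<xi>|lborel. fourier ?h \<xi> * complex_of_real (gauss (e *\<^sub>R \<xi>)))"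
    by (simp add: fourier_autocorrelation[OF f])
  also have "\<dots> = (LINT z|lborel. ?h z * fourier (\<lambda>\<xi>. complex_of_real (gauss (e *\<^sub>R \<xi>))) z)"
    by (rule fourier_multiplication_formula[OF h integrable_gauss_scaled[OF e]])
  also have "\<dots> = (LINT z|lborel. ?c * complex_of_real ((1 / e) ^ DIM('a)) * (?h z * complex_of_real (gauss ((1 / e) *\<^sub>R z))))"
    unfolding fourier_gauss_scaled[OF e] by (simp add: mult_ac)
  also have "\<dots> = ?c * complex_of_real ((1 / e) ^ DIM('a)) * (LINT z|lborel. ?h z * complex_of_real (gauss ((1 / e) *\<^sub>R z)))"
    by (rule integral_mult_right_zero)
  also have "(LINT z|lborel. ?h z * complex_of_real (gauss ((1 / e) *\<^sub>R z)))
      = e ^ DIM('a) *\<^sub>R (LINT z|lborel. ?h (e *\<^sub>R z) * complex_of_real (gauss z))"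
    using e by (subst integral_lborel_affine[of _ e 0]) auto
  finally show ?thesis using e by (simp add: scaleR_conv_of_real power_divide)
qed

text \<open>
  In \<open>gauss_weighted_plancherel\<close> let \<open>e\<close> decrease to \<open>0\<close>: the left side converges by monotone convergence,
  whether or not the limit is finite, and the right side by dominated convergence.
\<close>
lemma plancherel_bounded:
  fixes f :: "'a::euclidean_space \<Rightarrow> complex"
  assumes f: "integrable lborel f" and M: "\<And>x. norm (f x) \<le> M"
  shows "(\<integral>\<^sup>+\<xi>. ennreal ((norm (fourier f \<xi>))\<^sup>2) \<partial>lborel)
       = ennreal ((2 * pi) ^ DIM('a)) * (\<integral>\<^sup>+x. ennreal ((norm (f x))\<^sup>2) \<partial>lborel)"
proof -
  have [measurable]: "f \<in> borel_measurable borel" using f by auto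
  let ?h = "autocorrelation f" and ?c = "sqrt (2 * pi) ^ DIM('a)"
  have [measurable]: "?h \<in> borel_measurable borel" using integrable_autocorrelation[OF f] by auto
  \<comment> \<open>The widths must decrease, so that the Gaussian weights increase to 1 monotonically.\<close>
  define e where "e k = 1 / (1 + real k)" for k
  have e: "e k > 0" for k by (simp add: e_def add_pos_nonneg)
  have e0: "e \<longlonglongrightarrow> 0" unfolding e_def[abs_def] by real_asymp
  have M0: "M \<ge> 0" using M[of 0] norm_ge_zero order_trans by blast
  define I where "I k = (LINT \<xi>|lborel. (norm (fourier f \<xi>))\<^sup>2 * gauss (e k *\<^sub>R \<xi>))" for k
  have f2: "integrable lborel (\<lambda>x. (norm (f x))\<^sup>2)"
    by (rule Bochner_Integration.integrable_bound[of lborel "\<lambda>x. M * norm (f x)"])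
       (use f order_trans[OF M abs_ge_self] in \<open>auto simp: power2_eq_square abs_mult intro!: mult_right_mono\<close>)
  have h0: "?h 0 = complex_of_real (LINT x|lborel. (norm (f x))\<^sup>2)"
    unfolding autocorrelation_def integral_complex_of_real[symmetric]
    by (simp add: complex_norm_square[symmetric])
  have hlim: "(\<lambda>k. ?h (e k *\<^sub>R z)) \<longlonglongrightarrow> ?h 0" for z
  proof -
    have "(\<lambda>k. e k *\<^sub>R z) \<longlonglongrightarrow> 0" using tendsto_scaleR[OF e0 tendsto_const[of z]] by simp
    from translation_continuous_L1[OF f this]
    have "(\<lambda>k. M * translation_defect (\<lambda>k. e k *\<^sub>R z) f k) \<longlonglongrightarrow> 0"
      by (rule tendsto_mult_right_zero)
    then have "(\<lambda>k. ?h (e k *\<^sub>R z) - ?h 0) \<longlonglongrightarrow> 0"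
      by (rule tendsto_0_le[where K=1])
         (use autocorrelation_diff_le[OF f M] M0 in
           \<open>auto simp: translation_defect_def intro!: always_eventually order_trans[OF _ abs_ge_self]\<close>)
    then show ?thesis by (simp add: LIM_zero_iff)
  qed
  have hbound: "norm (?h z) \<le> M * (LINT x|lborel. norm (f x))" for z
  proof -
    have "norm (?h z) \<le> (LINT x|lborel. norm (f (x + z) * cnj (f x)))"
      unfolding autocorrelation_def by (rule integral_norm_bound)
    also have "\<dots> \<le> (LINT x|lborel. M * norm (f x))"
      by (rule Bochner_Integration.integral_mono')
         (use f M M0 in \<open>auto simp: norm_mult intro!: mult_right_mono\<close>)
    finally show ?thesis by simp
  qed
  have "(\<lambda>k. LINT z|lborel. ?h (e k *\<^sub>R z) * complex_of_real (gauss z))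
      \<longlonglongrightarrow> (LINT z|lborel. ?h 0 * complex_of_real (gauss (z::'a)))"
    by (rule integral_dominated_convergence[where w = "\<lambda>z. M * (LINT x|lborel. norm (f x)) * norm (complex_of_real (gauss z))"])
       (use hlim hbound integrable_norm[OF integrable_gauss] in
          \<open>auto simp: norm_mult intro!: tendsto_mult_right mult_right_mono\<close>)
  then have "(\<lambda>k. complex_of_real ?c * (LINT z|lborel. ?h (e k *\<^sub>R z) * complex_of_real (gauss z)))
      \<longlonglongrightarrow> complex_of_real ?c * (?h 0 * complex_of_real ?c)"
    by (intro tendsto_mult_left) (simp add: integral_gauss)
  moreover have "complex_of_real ?c * (LINT z|lborel. ?h (e k *\<^sub>R z) * complex_of_real (gauss z))
      = complex_of_real (I k)" for k
    unfolding I_def by (simp only: gauss_weighted_plancherel[OF f e, symmetric] integral_complex_of_real)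
  moreover have "complex_of_real ?c * (?h 0 * complex_of_real ?c)
      = complex_of_real ((2 * pi) ^ DIM('a) * (LINT x|lborel. (norm (f x))\<^sup>2))"
  proof -
    have "?c * ?c = (2 * pi) ^ DIM('a)"
      by (simp only: power_mult_distrib[symmetric] real_sqrt_mult_self) simp
    moreover have "?c * (t * ?c) = (?c * ?c) * t" for t :: real
      by (simp only: mult_ac)
    ultimately have "?c * (t * ?c) = (2 * pi) ^ DIM('a) * t" for t :: real
      by (simp only:)
    then show ?thesis
      unfolding h0 of_real_mult[symmetric] by (rule arg_cong)
  qed
  ultimately have "(\<lambda>k. complex_of_real (I k)) \<longlonglongrightarrow> complex_of_real ((2 * pi) ^ DIM('a) * (LINT x|lborel. (norm (f x))\<^sup>2))"
    by (simp only:)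
  then have Ilim: "I \<longlonglongrightarrow> (2 * pi) ^ DIM('a) * (LINT x|lborel. (norm (f x))\<^sup>2)"
    by (simp only: tendsto_of_real_iff)
  let ?g = "\<lambda>k \<xi>. ennreal ((norm (fourier f \<xi>))\<^sup>2 * gauss (e k *\<^sub>R \<xi>))"
  have In: "(\<integral>\<^sup>+\<xi>. ?g k \<xi> \<partial>lborel) = ennreal (I k)" for k
    unfolding I_def
  proof (rule nn_integral_eq_integral)
    have "integrable lborel (\<lambda>\<xi>. (LINT x|lborel. norm (f x))\<^sup>2 * norm (complex_of_real (gauss (e k *\<^sub>R \<xi>))))"
      using integrable_norm[OF integrable_gauss_scaled[OF e[of k]]] by (intro integrable_mult_right) auto
    then show "integrable lborel (\<lambda>\<xi>. (norm (fourier f \<xi>))\<^sup>2 * gauss (e k *\<^sub>R \<xi>))"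
      by (rule Bochner_Integration.integrable_bound)
         (auto simp: abs_mult gauss_pos less_imp_le intro!: mult_right_mono power_mono norm_fourier_le)
  qed (auto simp: gauss_pos less_imp_le)
  have inc: "incseq ?g"
  proof (intro incseq_SucI le_funI ennreal_leI mult_left_mono)
    fix k and \<xi> :: 'a
    have "e (Suc k) \<le> e k" by (simp add: e_def frac_le)
    then show "gauss (e k *\<^sub>R \<xi>) \<le> gauss (e (Suc k) *\<^sub>R \<xi>)"
      using e[of "Suc k"] by (auto simp: gauss_def power_mult_distrib intro!: mult_right_mono power_mono)
  qed simp
  have "(\<lambda>k. \<integral>\<^sup>+\<xi>. ?g k \<xi> \<partial>lborel) \<longlonglongrightarrow> (\<integral>\<^sup>+\<xi>. ennreal ((norm (fourier f \<xi>))\<^sup>2) \<partial>lborel)"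
  proof (rule nn_integral_LIMSEQ[OF inc])
    fix \<xi> :: 'a
    have "(\<lambda>k. exp (- (norm (e k *\<^sub>R \<xi>))\<^sup>2 / 2)) \<longlonglongrightarrow> exp (- (norm (0 *\<^sub>R \<xi>))\<^sup>2 / 2)"
      by (intro tendsto_intros e0) simp
    then have "(\<lambda>k. gauss (e k *\<^sub>R \<xi>)) \<longlonglongrightarrow> 1" by (simp add: gauss_def)
    then have "(\<lambda>k. (norm (fourier f \<xi>))\<^sup>2 * gauss (e k *\<^sub>R \<xi>)) \<longlonglongrightarrow> (norm (fourier f \<xi>))\<^sup>2 * 1"
      by (intro tendsto_intros)
    then show "(\<lambda>k. ?g k \<xi>) \<longlonglongrightarrow> ennreal ((norm (fourier f \<xi>))\<^sup>2)"
      by (intro tendsto_ennrealI) simp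
  qed simp
  moreover have "(\<lambda>k. \<integral>\<^sup>+\<xi>. ?g k \<xi> \<partial>lborel) \<longlonglongrightarrow> ennreal ((2 * pi) ^ DIM('a) * (LINT x|lborel. (norm (f x))\<^sup>2))"
    unfolding In using Ilim by (rule tendsto_ennrealI)
  ultimately have "(\<integral>\<^sup>+\<xi>. ennreal ((norm (fourier f \<xi>))\<^sup>2) \<partial>lborel)
      = ennreal ((2 * pi) ^ DIM('a) * (LINT x|lborel. (norm (f x))\<^sup>2))"
    by (rule LIMSEQ_unique)
  then show ?thesis
    using f2 by (simp add: nn_integral_eq_integral ennreal_mult)
qed

definition sq_norm :: "('a::euclidean_space \<Rightarrow> complex) \<Rightarrow> ennreal" where
  "sq_norm f = (\<integral>\<^sup>+x. ennreal ((norm (f x))\<^sup>2) \<partial>lborel)"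

text \<open>
  A substitute for the triangle inequality that can be stated for squared norms, infinite ones included.
  Pointwise it is \<open>(s p - q)\<^sup>2 / s \<ge> 0\<close> with \<open>p = \<bar>b\<bar>\<close> and \<open>q = \<bar>b - a\<bar>\<close>.
\<close>
lemma sq_norm_le_peter_paul:
  fixes a b :: "'a::euclidean_space \<Rightarrow> complex"
  assumes [measurable]: "a \<in> borel_measurable borel" "b \<in> borel_measurable borel" and s: "s > 0"
  shows "sq_norm a \<le> ennreal (1 + s) * sq_norm b + ennreal (1 + 1 / s) * sq_norm (\<lambda>x. b x - a x)"
proof -
  have "(norm (a x))\<^sup>2 \<le> (1 + s) * (norm (b x))\<^sup>2 + (1 + 1 / s) * (norm (b x - a x))\<^sup>2" for x
  proof -
    define p q where "p = norm (b x)" and "q = norm (b x - a x)"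
    have "norm (a x) \<le> p + q"
      using norm_triangle_ineq4[of "b x" "b x - a x"] by (simp add: p_def q_def)
    then have "(norm (a x))\<^sup>2 \<le> (p + q)\<^sup>2" by (intro power_mono) auto
    also have "(p + q)\<^sup>2 = (1 + s) * p\<^sup>2 + (1 + 1 / s) * q\<^sup>2 - (s * p - q)\<^sup>2 / s"
      using s by (simp add: field_simps power2_eq_square)
    also have "\<dots> \<le> (1 + s) * p\<^sup>2 + (1 + 1 / s) * q\<^sup>2" using s by simp
    finally show ?thesis by (simp add: p_def q_def)
  qed
  then have "sq_norm a \<le> (\<integral>\<^sup>+x. ennreal (1 + s) * ennreal ((norm (b x))\<^sup>2)
      + ennreal (1 + 1 / s) * ennreal ((norm (b x - a x))\<^sup>2) \<partial>lborel)"
    unfolding sq_norm_def using s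
    by (intro nn_integral_mono) (simp add: ennreal_mult[symmetric] ennreal_plus[symmetric] del: ennreal_plus)
  also have "\<dots> = ennreal (1 + s) * sq_norm b + ennreal (1 + 1 / s) * sq_norm (\<lambda>x. b x - a x)"
    unfolding sq_norm_def by (subst nn_integral_add) (simp_all add: nn_integral_cmult)
  finally show ?thesis .
qed

lemma ennreal_le_of_le_all_factors:
  fixes x y :: ennreal
  assumes "\<And>s::real. s > 0 \<Longrightarrow> x \<le> ennreal (1 + s) * y"
  shows "x \<le> y"
proof (cases "y = \<infinity>")
  case False
  then have y: "y < top" by (simp add: less_top)
  have "(\<lambda>k. 1 + 1 / (1 + real k)) \<longlonglongrightarrow> 1" by real_asymp
  then have "(\<lambda>k. y * ennreal (1 + 1 / (1 + real k))) \<longlonglongrightarrow> y * ennreal 1"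
    by (intro ennreal_tendsto_cmult[OF y] tendsto_ennrealI)
  moreover have "x \<le> y * ennreal (1 + 1 / (1 + real k))" for k
    using assms[of "1 / (1 + real k)"] by (simp add: mult.commute add_pos_nonneg)
  ultimately show ?thesis
    by (intro LIMSEQ_le_const[of _ y]) auto
qed simp

text \<open>
  Squared norms are continuous under mean-square convergence: apply \<open>sq_norm_le_peter_paul\<close> in both
  directions, let \<open>k\<close> tend to infinity and then \<open>s\<close> to \<open>0\<close>.
\<close>
lemma sq_norm_limit:
  fixes a :: "'a::euclidean_space \<Rightarrow> complex"
  assumes [measurable]: "a \<in> borel_measurable borel" "\<And>k. b k \<in> borel_measurable borel"
    and diff: "(\<lambda>k. sq_norm (\<lambda>x. b k x - a x)) \<longlonglongrightarrow> 0"
    and lim: "(\<lambda>k. sq_norm (b k)) \<longlonglongrightarrow> L"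
  shows "sq_norm a = L"
proof (rule antisym; rule ennreal_le_of_le_all_factors)
  fix s :: real assume s: "s > 0"
  have d0: "(\<lambda>k. ennreal (1 + 1 / s) * sq_norm (\<lambda>x. b k x - a x)) \<longlonglongrightarrow> ennreal (1 + 1 / s) * 0"
    by (intro ennreal_tendsto_cmult diff) simp
  have "(\<lambda>k. ennreal (1 + s) * sq_norm (b k) + ennreal (1 + 1 / s) * sq_norm (\<lambda>x. b k x - a x))
      \<longlonglongrightarrow> ennreal (1 + s) * L + ennreal (1 + 1 / s) * 0"
    by (intro tendsto_add d0 ennreal_tendsto_cmult lim) simp
  then show "sq_norm a \<le> ennreal (1 + s) * L"
    using sq_norm_le_peter_paul[of a "b _", OF _ _ s] by (intro LIMSEQ_le_const) auto
  have "(\<lambda>k. ennreal (1 + s) * sq_norm a + ennreal (1 + 1 / s) * sq_norm (\<lambda>x. b k x - a x))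
      \<longlonglongrightarrow> ennreal (1 + s) * sq_norm a + ennreal (1 + 1 / s) * 0"
    by (intro tendsto_add d0 tendsto_const)
  moreover have "sq_norm (\<lambda>x. a x - b k x) = sq_norm (\<lambda>x. b k x - a x)" for k
    by (simp add: sq_norm_def norm_minus_commute)
  ultimately show "L \<le> ennreal (1 + s) * sq_norm a"
    using sq_norm_le_peter_paul[of "b _" a, OF _ _ s] lim by (intro LIMSEQ_le[OF lim]) auto
qed

lemma integrable_truncate_value:
  fixes f :: "'a::euclidean_space \<Rightarrow> complex"
  assumes f: "integrable lborel f"
  shows "integrable lborel (\<lambda>x. if norm (f x) \<le> R then f x else 0)"
  by (rule Bochner_Integration.integrable_bound[OF f]) (use f in auto)

lemma fourier_dominated_tendsto:
  fixes f :: "'a::euclidean_space \<Rightarrow> complex"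
  assumes f: "integrable lborel f" and [measurable]: "\<And>k. g k \<in> borel_measurable borel"
    and le: "\<And>k x. norm (g k x) \<le> norm (f x)"
    and lim: "\<And>x. (\<lambda>k. g k x) \<longlonglongrightarrow> f x"
  shows "(\<lambda>k. fourier (g k) \<xi>) \<longlonglongrightarrow> fourier f \<xi>"
  unfolding fourier_def
  by (rule integral_dominated_convergence[where w = "\<lambda>x. norm (f x)"])
     (use f in \<open>auto intro!: tendsto_intros lim le\<close>)

lemma truncate_tendsto:
  fixes h :: "'a \<Rightarrow> real" and c :: "'b::{zero,topological_space}"
  shows "(\<lambda>k. if h x \<le> real k then c else 0) \<longlonglongrightarrow> c"
proof -
  obtain N where "h x \<le> real N" using real_arch_simple by blast
  then show ?thesis
    by (intro tendsto_eventually eventually_sequentiallyI[of N]) auto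
qed

lemma sq_norm_truncate_tendsto:
  fixes f :: "'a::euclidean_space \<Rightarrow> complex"
  assumes [measurable]: "f \<in> borel_measurable borel" "h \<in> borel_measurable borel"
  shows "(\<lambda>k. sq_norm (\<lambda>x. if h x \<le> real k then f x else 0)) \<longlonglongrightarrow> sq_norm f"
  unfolding sq_norm_def
proof (rule nn_integral_LIMSEQ)
  show "incseq (\<lambda>k x. ennreal ((norm (if h x \<le> real k then f x else 0))\<^sup>2))"
    by (intro incseq_SucI le_funI) auto
  show "(\<lambda>k. ennreal ((norm (if h x \<le> real k then f x else 0))\<^sup>2)) \<longlonglongrightarrow> ennreal ((norm (f x))\<^sup>2)" for x
    by (intro tendsto_ennrealI tendsto_intros truncate_tendsto)
qed simp

lemma sq_norm_truncate_diff_tendsto: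
  fixes f :: "'a::euclidean_space \<Rightarrow> complex"
  assumes [measurable]: "f \<in> borel_measurable borel" "h \<in> borel_measurable borel" and fin: "sq_norm f < \<infinity>"
  shows "(\<lambda>k. sq_norm (\<lambda>x. (if h x \<le> real k then f x else 0) - f x)) \<longlonglongrightarrow> 0"
proof -
  have "(\<lambda>k. sq_norm (\<lambda>x. (if h x \<le> real k then f x else 0) - f x)) \<longlonglongrightarrow> (\<integral>\<^sup>+x. 0 \<partial>(lborel :: 'a measure))"
    unfolding sq_norm_def
  proof (rule nn_integral_dominated_convergence[where w = "\<lambda>x. ennreal ((norm (f x))\<^sup>2)"])
    show "AE x in lborel. (\<lambda>k. ennreal ((norm ((if h x \<le> real k then f x else 0) - f x))\<^sup>2)) \<longlonglongrightarrow> 0"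
    proof (rule AE_I2)
      fix x :: 'a
      have "(\<lambda>k. ennreal ((norm ((if h x \<le> real k then f x else 0) - f x))\<^sup>2)) \<longlonglongrightarrow> ennreal ((norm (f x - f x))\<^sup>2)"
        by (intro tendsto_ennrealI tendsto_intros truncate_tendsto)
      then show "(\<lambda>k. ennreal ((norm ((if h x \<le> real k then f x else 0) - f x))\<^sup>2)) \<longlonglongrightarrow> 0" by simp
    qed
  qed (use fin in \<open>auto simp: sq_norm_def\<close>)
  then show ?thesis by simp
qed

text \<open>
  Truncating the values of \<open>f\<close> gives bounded functions whose transforms converge pointwise, so Fatou's
  lemma yields one half of the identity.  Applied to differences, this half yields mean-square
  convergence of the transforms, and with it the equality in \<open>plancherel_L1_L2\<close>.
\<close>
lemma sq_norm_fourier_le: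
  fixes f :: "'a::euclidean_space \<Rightarrow> complex"
  assumes f: "integrable lborel f"
  shows "sq_norm (fourier f) \<le> ennreal ((2 * pi) ^ DIM('a)) * sq_norm f"
proof -
  have [measurable]: "f \<in> borel_measurable borel" using f by auto
  define g where "g k x = (if norm (f x) \<le> real k then f x else 0)" for k :: nat and x
  have gm[measurable]: "g k \<in> borel_measurable borel" for k unfolding g_def[abs_def] by simp
  have gi: "integrable lborel (g k)" for k unfolding g_def[abs_def] by (rule integrable_truncate_value[OF f])
  have lim: "(\<lambda>k. fourier (g k) \<xi>) \<longlonglongrightarrow> fourier f \<xi>" for \<xi>
    by (rule fourier_dominated_tendsto[OF f]) (auto simp: g_def[abs_def] intro: truncate_tendsto[of "\<lambda>x. norm (f x)"])
  have "sq_norm (fourier f) = (\<integral>\<^sup>+\<xi>. liminf (\<lambda>k. ennreal ((norm (fourier (g k) \<xi>))\<^sup>2)) \<partial>lborel)"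
    unfolding sq_norm_def
    by (intro nn_integral_cong lim_imp_Liminf[symmetric] tendsto_ennrealI tendsto_intros lim) simp
  also have "\<dots> \<le> liminf (\<lambda>k. \<integral>\<^sup>+\<xi>. ennreal ((norm (fourier (g k) \<xi>))\<^sup>2) \<partial>lborel)"
    by (rule nn_integral_liminf) simp
  also have "\<dots> \<le> limsup (\<lambda>k. \<integral>\<^sup>+\<xi>. ennreal ((norm (fourier (g k) \<xi>))\<^sup>2) \<partial>lborel)"
    by (rule Liminf_le_Limsup) simp
  also have "\<dots> \<le> ennreal ((2 * pi) ^ DIM('a)) * sq_norm f"
  proof (rule Limsup_bounded, rule always_eventually, rule allI)
    fix k
    have "(\<integral>\<^sup>+\<xi>. ennreal ((norm (fourier (g k) \<xi>))\<^sup>2) \<partial>lborel) = ennreal ((2 * pi) ^ DIM('a)) * sq_norm (g k)"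
      unfolding sq_norm_def by (rule plancherel_bounded[OF gi, where M = "real k"]) (simp add: g_def)
    also have "sq_norm (g k) \<le> sq_norm f"
      unfolding sq_norm_def by (intro nn_integral_mono) (simp add: g_def)
    finally show "(\<integral>\<^sup>+\<xi>. ennreal ((norm (fourier (g k) \<xi>))\<^sup>2) \<partial>lborel) \<le> ennreal ((2 * pi) ^ DIM('a)) * sq_norm f"
      by (simp add: mult_left_mono)
  qed
  finally show ?thesis .
qed

lemma plancherel_L1_L2:
  fixes f :: "'a::euclidean_space \<Rightarrow> complex"
  assumes f: "integrable lborel f" and fin: "sq_norm f < \<infinity>"
  shows "sq_norm (fourier f) = ennreal ((2 * pi) ^ DIM('a)) * sq_norm f"
proof -
  have [measurable]: "f \<in> borel_measurable borel" using f by auto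
  let ?c = "ennreal ((2 * pi) ^ DIM('a))"
  define g where "g k x = (if norm (f x) \<le> real k then f x else 0)" for k :: nat and x
  have gm[measurable]: "g k \<in> borel_measurable borel" for k unfolding g_def[abs_def] by simp
  have gi: "integrable lborel (g k)" for k unfolding g_def[abs_def] by (rule integrable_truncate_value[OF f])
  show ?thesis
  proof (rule sq_norm_limit[where b = "\<lambda>k. fourier (g k)"])
    have "(\<lambda>k. ?c * sq_norm (\<lambda>x. g k x - f x)) \<longlonglongrightarrow> ?c * 0"
      unfolding g_def by (intro ennreal_tendsto_cmult sq_norm_truncate_diff_tendsto fin) simp_all
    moreover have "sq_norm (\<lambda>\<xi>. fourier (g k) \<xi> - fourier f \<xi>) \<le> ?c * sq_norm (\<lambda>x. g k x - f x)" for k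
    proof -
      have "fourier (\<lambda>x. g k x - f x) = (\<lambda>\<xi>. fourier (g k) \<xi> - fourier f \<xi>)"
        by (rule ext) (rule fourier_diff[OF gi f])
      then show ?thesis
        using sq_norm_fourier_le[OF Bochner_Integration.integrable_diff[OF gi[of k] f]] by simp
    qed
    ultimately show "(\<lambda>k. sq_norm (\<lambda>\<xi>. fourier (g k) \<xi> - fourier f \<xi>)) \<longlonglongrightarrow> 0"
      by (intro tendsto_sandwich[OF _ _ tendsto_const, of 0 "\<lambda>k. sq_norm (\<lambda>\<xi>. fourier (g k) \<xi> - fourier f \<xi>)" sequentially "\<lambda>k. ?c * sq_norm (\<lambda>x. g k x - f x)"]) simp_all
    have "(\<lambda>k. ?c * sq_norm (g k)) \<longlonglongrightarrow> ?c * sq_norm f"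
      unfolding g_def by (intro ennreal_tendsto_cmult sq_norm_truncate_tendsto) simp_all
    moreover have "sq_norm (fourier (g k)) = ?c * sq_norm (g k)" for k
      unfolding sq_norm_def by (rule plancherel_bounded[OF gi, where M = "real k"]) (simp add: g_def)
    ultimately show "(\<lambda>k. sq_norm (fourier (g k))) \<longlonglongrightarrow> ?c * sq_norm f" by simp
  qed simp_all
qed

lemma L2_space_sq_norm:
  assumes "f \<in> L2_space"
  shows "f \<in> borel_measurable borel" "sq_norm f < \<infinity>" "sq_norm f = ennreal ((norm_L2 f)\<^sup>2)"
proof -
  show m: "f \<in> borel_measurable borel" using assms by (simp add: L2_space_def)
  have i: "integrable lborel (\<lambda>x. (norm (f x))\<^sup>2)" using assms by (simp add: L2_space_def)
  show eq: "sq_norm f = ennreal ((norm_L2 f)\<^sup>2)"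
    unfolding sq_norm_def norm_L2_def using i by (simp add: nn_integral_eq_integral)
  show "sq_norm f < \<infinity>" by (simp add: eq)
qed

lemma integrable_L2_truncate_ball:
  assumes "f \<in> L2_space"
  shows "integrable lborel (\<lambda>x. if norm x \<le> R then f x else 0)"
proof -
  have [measurable]: "f \<in> borel_measurable borel" using assms by (simp add: L2_space_def)
  have i: "integrable lborel (\<lambda>x. (norm (f x))\<^sup>2)" using assms by (simp add: L2_space_def)
  have "integrable lborel (indicator (cball 0 R) :: 'a \<Rightarrow> real)"
    using emeasure_bounded_finite[of "cball (0::'a) R"] by (simp add: less_top)
  with i have "integrable lborel (\<lambda>x. indicator (cball 0 R) x + (norm (f x))\<^sup>2 :: real)"
    by (intro Bochner_Integration.integrable_add)
  then show ?thesis
  proof (rule Bochner_Integration.integrable_bound)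
    have "r \<le> 1 + r\<^sup>2" for r :: real
      using zero_le_power2[of "r - 1/2"] by (simp add: power2_eq_square algebra_simps)
    then show "AE x in lborel. norm (if norm x \<le> R then f x else 0)
        \<le> norm (indicator (cball 0 R) x + (norm (f x))\<^sup>2 :: real)"
      by (auto simp: indicator_def)
  qed simp
qed

lemma has_L2_fourier_sequence:
  assumes "has_L2_fourier f g"
  shows "(\<lambda>k. sq_norm (\<lambda>\<xi>. fourier (\<lambda>x. if norm x \<le> real k then f x else 0) \<xi> - g \<xi>)) \<longlonglongrightarrow> 0"
  unfolding sq_norm_def
  by (rule filterlim_compose[OF _ filterlim_real_sequentially]) (use assms in \<open>simp add: has_L2_fourier_def\<close>)

text \<open>
  Truncations of a square-integrable function to balls are integrable, and by definition their transforms
  converge to \<open>g\<close> in the mean square, so \<open>plancherel_L1_L2\<close> passes to the limit.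
\<close>
theorem plancherel_L2:
  fixes f :: "'a::euclidean_space \<Rightarrow> complex"
  assumes fg: "has_L2_fourier f g"
  shows "sq_norm g = ennreal ((2 * pi) ^ DIM('a)) * sq_norm f"
proof -
  let ?c = "ennreal ((2 * pi) ^ DIM('a))"
  have f: "f \<in> L2_space" and g: "g \<in> L2_space" using fg by (simp_all add: has_L2_fourier_def)
  note [measurable] = L2_space_sq_norm(1)[OF f] L2_space_sq_norm(1)[OF g]
  define b where "b k x = (if norm x \<le> real k then f x else 0)" for k :: nat and x
  have [measurable]: "b k \<in> borel_measurable borel" for k unfolding b_def[abs_def] by simp
  show ?thesis
  proof (rule sq_norm_limit[where b = "\<lambda>k. fourier (b k)"])
    show "(\<lambda>k. sq_norm (\<lambda>\<xi>. fourier (b k) \<xi> - g \<xi>)) \<longlonglongrightarrow> 0"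
      unfolding b_def by (rule has_L2_fourier_sequence[OF fg])
    have "(\<lambda>k. ?c * sq_norm (b k)) \<longlonglongrightarrow> ?c * sq_norm f"
      unfolding b_def by (intro ennreal_tendsto_cmult sq_norm_truncate_tendsto) simp_all
    moreover have "sq_norm (fourier (b k)) = ?c * sq_norm (b k)" for k
    proof (rule plancherel_L1_L2)
      show "integrable lborel (b k)" unfolding b_def[abs_def] by (rule integrable_L2_truncate_ball[OF f])
      have "sq_norm (b k) \<le> sq_norm f"
        unfolding sq_norm_def by (intro nn_integral_mono) (simp add: b_def)
      then show "sq_norm (b k) < \<infinity>" using L2_space_sq_norm(2)[OF f] by (rule le_less_trans)
    qed
    ultimately show "(\<lambda>k. sq_norm (fourier (b k))) \<longlonglongrightarrow> ?c * sq_norm f" by simp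
  qed simp_all
qed

lemma norm_L2_nonneg [simp]: "0 \<le> norm_L2 f"
  by (simp add: norm_L2_def)

corollary norm_L2_fourier:
  fixes f :: "'a::euclidean_space \<Rightarrow> complex"
  assumes fg: "has_L2_fourier f g"
  shows "(norm_L2 g)\<^sup>2 = (2 * pi) ^ DIM('a) * (norm_L2 f)\<^sup>2"
proof -
  have f: "f \<in> L2_space" and g: "g \<in> L2_space" using fg by (simp_all add: has_L2_fourier_def)
  have "ennreal ((norm_L2 g)\<^sup>2) = ennreal ((2 * pi) ^ DIM('a) * (norm_L2 f)\<^sup>2)"
    using plancherel_L2[OF fg] by (simp add: L2_space_sq_norm(3)[OF f] L2_space_sq_norm(3)[OF g] ennreal_mult)
  then show ?thesis by simp
qed

text \<open>
  The transforms of the truncations converge to \<open>fourier f\<close> pointwise and to \<open>g\<close> in the mean square; by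
  Fatou's lemma both limits agree almost everywhere.
\<close>
lemma has_L2_fourier_eq_fourier:
  fixes f :: "'a::euclidean_space \<Rightarrow> complex"
  assumes f: "integrable lborel f" and fg: "has_L2_fourier f g"
  shows "AE \<xi> in lborel. g \<xi> = fourier f \<xi>"
proof -
  have g: "g \<in> L2_space" using fg by (simp_all add: has_L2_fourier_def)
  note [measurable] = L2_space_sq_norm(1)[OF g]
  have [measurable]: "f \<in> borel_measurable borel" using f by auto
  define b where "b k x = (if norm x \<le> real k then f x else 0)" for k :: nat and x
  have [measurable]: "b k \<in> borel_measurable borel" for k unfolding b_def[abs_def] by simp
  have lim: "(\<lambda>k. fourier (b k) \<xi>) \<longlonglongrightarrow> fourier f \<xi>" for \<xi>
    by (rule fourier_dominated_tendsto[OF f]) (auto simp: b_def[abs_def] intro: truncate_tendsto[of norm])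
  have "sq_norm (\<lambda>\<xi>. fourier f \<xi> - g \<xi>) = (\<integral>\<^sup>+\<xi>. liminf (\<lambda>k. ennreal ((norm (fourier (b k) \<xi> - g \<xi>))\<^sup>2)) \<partial>lborel)"
    unfolding sq_norm_def
    by (intro nn_integral_cong lim_imp_Liminf[symmetric] tendsto_ennrealI tendsto_intros lim) simp
  also have "\<dots> \<le> liminf (\<lambda>k. \<integral>\<^sup>+\<xi>. ennreal ((norm (fourier (b k) \<xi> - g \<xi>))\<^sup>2) \<partial>lborel)"
    by (rule nn_integral_liminf) simp
  also have "\<dots> = 0"
    using has_L2_fourier_sequence[OF fg] unfolding sq_norm_def b_def[symmetric]
    by (intro lim_imp_Liminf) simp_all
  finally have "(\<integral>\<^sup>+\<xi>. ennreal ((norm (fourier f \<xi> - g \<xi>))\<^sup>2) \<partial>lborel) = 0"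
    unfolding sq_norm_def by simp
  then have "AE \<xi> in lborel. ennreal ((norm (fourier f \<xi> - g \<xi>))\<^sup>2) = 0"
    by (subst (asm) nn_integral_0_iff_AE) auto
  then show ?thesis by (auto elim!: eventually_mono)
qed

text \<open>
  The first moment bounds the modulus of continuity of the transform at \<open>0\<close>, because
  \<open>\<bar>exp (- \<i> \<theta>) - 1\<bar> \<le> \<bar>\<theta>\<bar>\<close>.
\<close>
lemma
  assumes "f \<in> L11_space"
  shows norm_L1_le_L11: "norm_L1 f \<le> norm_L11 f"
    and norm_fourier_minus_integral_le: "norm (fourier f \<xi> - (LINT x|lborel. f x)) \<le> norm \<xi> * norm_L11 f"
proof -
  have f: "integrable lborel f" and xf: "integrable lborel (\<lambda>x. (1 + norm x) * norm (f x))"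
    using assms by (simp_all add: L11_space_def L1_space_def)
  show "norm_L1 f \<le> norm_L11 f"
    unfolding norm_L1_def norm_L11_def
    by (rule integral_mono) (use f xf in \<open>auto simp: algebra_simps\<close>)
  have "fourier f \<xi> - (LINT x|lborel. f x) = (LINT x|lborel. exp (- \<i> * complex_of_real (x \<bullet> \<xi>)) * f x - f x)"
    unfolding fourier_def
    by (rule Bochner_Integration.integral_diff[symmetric, OF integrable_fourier_integrand[OF f] f])
  also have "norm \<dots> \<le> (LINT x|lborel. norm \<xi> * ((1 + norm x) * norm (f x)))"
  proof (rule Bochner_Integration.integral_norm_bound_integral)
    show "integrable lborel (\<lambda>x. exp (- \<i> * complex_of_real (x \<bullet> \<xi>)) * f x - f x)"
      by (rule Bochner_Integration.integrable_diff[OF integrable_fourier_integrand[OF f] f])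
    fix x
    have "norm (exp (- \<i> * complex_of_real (x \<bullet> \<xi>)) - 1) \<le> \<bar>x \<bullet> \<xi>\<bar>"
      using iexp_approx1[of "- (x \<bullet> \<xi>)" 0] by simp
    also have "\<bar>x \<bullet> \<xi>\<bar> \<le> norm \<xi> * (1 + norm x)"
      using Cauchy_Schwarz_ineq2[of x \<xi>] by (simp add: algebra_simps add_increasing)
    finally have "norm ((exp (- \<i> * complex_of_real (x \<bullet> \<xi>)) - 1) * f x) \<le> norm \<xi> * (1 + norm x) * norm (f x)"
      unfolding norm_mult by (rule mult_right_mono) simp
    then show "norm (exp (- \<i> * complex_of_real (x \<bullet> \<xi>)) * f x - f x) \<le> norm \<xi> * ((1 + norm x) * norm (f x))"
      by (simp add: left_diff_distrib mult.assoc)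
  qed (use xf in simp)
  finally show "norm (fourier f \<xi> - (LINT x|lborel. f x)) \<le> norm \<xi> * norm_L11 f"
    by (simp add: norm_L11_def)
qed

section \<open>The oscillator at a single frequency\<close>

lemma first_order_linear_ode:
  fixes y :: "real \<Rightarrow> 'b::real_normed_vector"
  assumes y: "\<And>t. t \<ge> 0 \<Longrightarrow> (y has_vector_derivative l *\<^sub>R y t) (at t within {0..})" and t: "t \<ge> 0"
  shows "y t = exp (l * t) *\<^sub>R y 0"
proof -
  \<comment> \<open>The integrating factor makes the derivative vanish.\<close>
  define \<phi> where "\<phi> t = exp (- l * t) *\<^sub>R y t" for t
  have "(\<phi> has_vector_derivative 0) (at t within {0..})" if "t \<in> {0..}" for t
  proof -
    have "((\<lambda>t. exp (- l * t)) has_real_derivative - l * exp (- l * t)) (at t within {0..})"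
      by (auto intro!: derivative_eq_intros)
    then have "(\<phi> has_vector_derivative exp (- l * t) *\<^sub>R (l *\<^sub>R y t) + (- l * exp (- l * t)) *\<^sub>R y t) (at t within {0..})"
      unfolding \<phi>_def using y[of t] that by (intro has_vector_derivative_scaleR) auto
    then show ?thesis by (simp add: mult.commute)
  qed
  then obtain c where "\<And>t. t \<in> {0..} \<Longrightarrow> \<phi> t = c"
    using has_vector_derivative_zero_constant[of "{0..}" \<phi>] by auto
  then have "\<phi> t = \<phi> 0" using t by simp
  then have "exp (l * t) *\<^sub>R \<phi> t = exp (l * t) *\<^sub>R y 0" by (simp add: \<phi>_def)
  then show ?thesis by (simp add: \<phi>_def exp_minus)
qed

text \<open>
  The equation \<open>W'' + b W' + r\<^sup>2 W = 0\<close> as a first-order system for \<open>W\<close> and its velocity \<open>V\<close>, with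
  one-sided derivatives at time \<open>0\<close>.
\<close>
definition damped_oscillator ::
    "real \<Rightarrow> real \<Rightarrow> (real \<Rightarrow> 'b::real_normed_vector) \<Rightarrow> (real \<Rightarrow> 'b) \<Rightarrow> bool" where
  "damped_oscillator b r W V \<longleftrightarrow> (\<forall>t\<ge>0.
     (W has_vector_derivative V t) (at t within {0..}) \<and>
     (V has_vector_derivative - (b *\<^sub>R V t + r\<^sup>2 *\<^sub>R W t)) (at t within {0..}))"

text \<open>
  The second-order operator factors as \<open>(d/dt - p) (d/dt - q)\<close>, so \<open>V - q W\<close> solves a first-order
  equation.  Doing this for both roots determines the solution without a uniqueness theorem for systems.
\<close>
lemma damped_oscillator_factor:
  fixes W V :: "real \<Rightarrow> 'b::real_normed_vector"
  assumes osc: "damped_oscillator b r W V" and sum: "p + q = - b" and prod: "p * q = r\<^sup>2" and t: "t \<ge> 0"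
  shows "V t - q *\<^sub>R W t = exp (p * t) *\<^sub>R (V 0 - q *\<^sub>R W 0)"
proof (rule first_order_linear_ode[OF _ t])
  fix s :: real assume s: "s \<ge> 0"
  have "((\<lambda>t. V t - q *\<^sub>R W t) has_vector_derivative - (b *\<^sub>R V s + r\<^sup>2 *\<^sub>R W s) - q *\<^sub>R V s) (at s within {0..})"
    using osc s unfolding damped_oscillator_def
    by (intro has_vector_derivative_diff bounded_linear.has_vector_derivative[OF bounded_linear_scaleR_right]) auto
  moreover have "- (b *\<^sub>R V s + r\<^sup>2 *\<^sub>R W s) - q *\<^sub>R V s = p *\<^sub>R (V s - q *\<^sub>R W s)"
  proof -
    have b: "b = - p - q" using sum by simp
    show ?thesis unfolding b prod[symmetric] by (simp add: algebra_simps)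
  qed
  ultimately show "((\<lambda>t. V t - q *\<^sub>R W t) has_vector_derivative p *\<^sub>R (V s - q *\<^sub>R W s)) (at s within {0..})"
    by simp
qed

lemma overdamped_solution:
  fixes W V :: "real \<Rightarrow> 'b::real_normed_vector"
  assumes osc: "damped_oscillator b r W V" and sum: "p + q = - b" and prod: "p * q = r\<^sup>2" and pq: "q < p" and t: "t \<ge> 0"
  shows "W t = ((exp (p * t) - exp (q * t)) / (p - q)) *\<^sub>R V 0
             + ((p * exp (q * t) - q * exp (p * t)) / (p - q)) *\<^sub>R W 0"
proof -
  have "(p - q) *\<^sub>R W t = (V t - q *\<^sub>R W t) - (V t - p *\<^sub>R W t)"
    by (simp add: algebra_simps)
  also have "\<dots> = exp (p * t) *\<^sub>R (V 0 - q *\<^sub>R W 0) - exp (q * t) *\<^sub>R (V 0 - p *\<^sub>R W 0)"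
    using damped_oscillator_factor[OF osc sum prod t] damped_oscillator_factor[OF osc _ _ t, of q p] sum prod
    by (simp add: add.commute mult.commute)
  also have "\<dots> = (exp (p * t) - exp (q * t)) *\<^sub>R V 0 + (p * exp (q * t) - q * exp (p * t)) *\<^sub>R W 0"
    by (simp add: algebra_simps)
  finally have "(1 / (p - q)) *\<^sub>R ((p - q) *\<^sub>R W t) = (1 / (p - q)) *\<^sub>R
      ((exp (p * t) - exp (q * t)) *\<^sub>R V 0 + (p * exp (q * t) - q * exp (p * t)) *\<^sub>R W 0)" by simp
  then show ?thesis using pq by (simp add: scaleR_add_right)
qed

text \<open>
  Put \<open>D = p - q\<close> for the roots \<open>q < p\<close>.  The hypotheses on \<open>b\<close> give \<open>\<surd>(\<kappa>\<^sup>2 - 4) r \<le> D \<le> b \<le> \<mu> r\<close>, and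
  \<open>p q = r\<^sup>2\<close> with \<open>-q \<le> \<mu> r\<close> forces \<open>p \<le> - r / \<mu>\<close>.  The velocity response is
  \<open>exp (p t) (1 - exp (- D t)) / D = exp (q t) (exp (D t) - 1) / D\<close>, and \<open>exp x \<ge> 1 + x\<close> bounds the first
  form above by \<open>t exp (p t)\<close> and the second below by \<open>t exp (q t)\<close>.  The numerator of the
  position response is at most \<open>(\<bar>p\<bar> + \<bar>q\<bar>) exp (p t) = b exp (p t)\<close>, and \<open>b / D\<close> is bounded.
\<close>
lemma overdamped_bounds:
  fixes W V :: "real \<Rightarrow> 'b::real_normed_vector"
  assumes osc: "damped_oscillator b r W V" and r: "r > 0" and kappa: "\<kappa> > 2" and lo: "\<kappa> * r \<le> b" and hi: "b \<le> \<mu> * r"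
    and t: "t \<ge> 0"
  defines "C \<equiv> \<mu> / sqrt (\<kappa>\<^sup>2 - 4)"
  shows "norm (W t) \<le> exp (- (r * t / \<mu>)) * (t * norm (V 0) + C * norm (W 0))"
    and "r * t \<le> 1 \<Longrightarrow> exp (- \<mu>) * t * norm (V 0) - C * norm (W 0) \<le> norm (W t)"
proof -
  define d where "d = sqrt (\<kappa>\<^sup>2 - 4)"
  have "\<kappa>\<^sup>2 > 2\<^sup>2" using kappa by (intro power_strict_mono) auto
  then have d: "d > 0" "d\<^sup>2 = \<kappa>\<^sup>2 - 4" by (simp_all add: d_def)
  have mu: "\<mu> \<ge> \<kappa>" using order_trans[OF lo hi] r by simp
  then have mu0: "\<mu> > 0" using kappa by simp
  have b0: "b > 0" using lo r kappa mult_pos_pos[of \<kappa> r] by linarith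
  have b2r: "b \<ge> 2 * r" using mult_right_mono[of 2 \<kappa> r] r kappa by (intro order_trans[OF _ lo]) auto
  define D where "D = sqrt (b\<^sup>2 - 4 * r\<^sup>2)"
  have "(\<kappa> * r)\<^sup>2 \<le> b\<^sup>2" using lo r kappa by (intro power_mono) auto
  then have D2: "(d * r)\<^sup>2 \<le> b\<^sup>2 - 4 * r\<^sup>2"
    by (simp add: power_mult_distrib d(2) algebra_simps)
  then have "b\<^sup>2 - 4 * r\<^sup>2 \<ge> 0" by (rule order_trans[rotated]) simp
  then have Dsq: "D\<^sup>2 = b\<^sup>2 - 4 * r\<^sup>2" by (simp add: D_def)
  have Dlo: "d * r \<le> D" unfolding D_def by (rule real_le_rsqrt[OF D2])
  then have D0: "D > 0" using d(1) r mult_pos_pos[of d r] by linarith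
  have Dhi: "D \<le> b" using b0 unfolding D_def by (intro real_le_lsqrt) auto
  define p q where "p = (- b + D) / 2" and "q = (- b - D) / 2"
  have sum: "p + q = - b" and diff: "p - q = D" and prod: "p * q = r\<^sup>2"
    using Dsq by (simp_all add: p_def q_def field_simps power2_eq_square)
  have qp: "q < p" using diff D0 by simp
  have p0: "p \<le> 0" using Dhi by (simp add: p_def)
  have q0: "q \<le> 0" using p0 qp by simp
  have "2 * q = - b - D" by (simp add: q_def)
  then have qlo: "- q \<le> \<mu> * r" using Dhi hi by linarith
  have phi: "p \<le> - (r / \<mu>)"
  proof -
    have "r * r = (- p) * (- q)" using prod by (simp add: power2_eq_square)
    also have "\<dots> \<le> (- p) * (\<mu> * r)" using qlo p0 by (intro mult_left_mono) auto
    finally have "r * r \<le> r * (- p * \<mu>)" by (simp add: mult_ac)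
    then have "r \<le> - p * \<mu>" using r by (simp only: mult_le_cancel_left_pos)
    then show ?thesis using mu0 by (simp add: field_simps)
  qed
  define B A where "B = (exp (p * t) - exp (q * t)) / (p - q)" and "A = (p * exp (q * t) - q * exp (p * t)) / (p - q)"
  have W: "W t = B *\<^sub>R V 0 + A *\<^sub>R W 0"
    unfolding A_def B_def by (rule overdamped_solution[OF osc sum prod qp t])
  have ept: "exp (p * t) \<le> exp (- (r * t / \<mu>))"
    using mult_right_mono[OF phi t] by simp
  have Dt: "q * t + D * t = p * t" using diff by (simp add: algebra_simps)
  have Bhi: "B \<le> t * exp (p * t)"
  proof -
    have "exp (q * t) = exp (p * t) * exp (- (D * t))"
      unfolding exp_add[symmetric] using Dt by simp
    then have "exp (p * t) - exp (q * t) = exp (p * t) * (1 - exp (- (D * t)))"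
      by (simp add: algebra_simps)
    also have "\<dots> \<le> exp (p * t) * (D * t)"
    proof (rule mult_left_mono)
      show "1 - exp (- (D * t)) \<le> D * t" using exp_ge_add_one_self[of "- (D * t)"] by linarith
    qed simp
    finally show ?thesis unfolding B_def diff using D0 by (simp add: field_simps)
  qed
  have Blo: "t * exp (q * t) \<le> B"
  proof -
    have "exp (p * t) = exp (q * t) * exp (D * t)"
      unfolding exp_add[symmetric] using Dt by simp
    then have "exp (p * t) - exp (q * t) = exp (q * t) * (exp (D * t) - 1)"
      by (simp add: algebra_simps)
    moreover have "exp (q * t) * (D * t) \<le> exp (q * t) * (exp (D * t) - 1)"
    proof (rule mult_left_mono)
      show "D * t \<le> exp (D * t) - 1" using exp_ge_add_one_self[of "D * t"] by linarith
    qed simp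
    ultimately show ?thesis unfolding B_def diff using D0 by (simp add: field_simps)
  qed
  have B0: "B \<ge> 0" by (rule order_trans[OF _ Blo]) (use t in simp)
  have Ahi: "\<bar>A\<bar> \<le> C * exp (p * t)"
  proof -
    have "exp (q * t) \<le> exp (p * t)" using qp t by (simp add: mult_right_mono)
    then have "\<bar>p * exp (q * t)\<bar> \<le> (- p) * exp (p * t)"
      using p0 by (simp add: abs_mult mult_left_mono_neg)
    moreover have "\<bar>q * exp (p * t)\<bar> = (- q) * exp (p * t)" using q0 by (simp add: abs_mult)
    ultimately have "\<bar>p * exp (q * t) - q * exp (p * t)\<bar> \<le> (- p) * exp (p * t) + (- q) * exp (p * t)"
      using abs_triangle_ineq4[of "p * exp (q * t)" "q * exp (p * t)"] by linarith
    also have "\<dots> = - (p + q) * exp (p * t)" by (simp add: algebra_simps)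
    also have "\<dots> = b * exp (p * t)" unfolding sum by simp
    finally have "\<bar>A\<bar> \<le> b * exp (p * t) / D"
      unfolding A_def diff using D0 by (simp add: divide_right_mono)
    also have "\<dots> \<le> (\<mu> * r) * exp (p * t) / (d * r)"
      using hi Dlo d(1) r b0 by (intro frac_le mult_right_mono) auto
    also have "\<dots> = C * exp (p * t)" using r unfolding C_def d_def by simp
    finally show ?thesis .
  qed
  have C0: "C \<ge> 0" unfolding C_def d_def[symmetric] using mu0 d(1) by simp
  show "norm (W t) \<le> exp (- (r * t / \<mu>)) * (t * norm (V 0) + C * norm (W 0))"
  proof -
    have "norm (W t) \<le> B * norm (V 0) + \<bar>A\<bar> * norm (W 0)"
      unfolding W using B0 norm_triangle_ineq[of "B *\<^sub>R V 0" "A *\<^sub>R W 0"] by simp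
    also have "\<dots> \<le> (t * exp (p * t)) * norm (V 0) + (C * exp (p * t)) * norm (W 0)"
      using Bhi Ahi by (intro add_mono mult_right_mono) auto
    also have "\<dots> = exp (p * t) * (t * norm (V 0) + C * norm (W 0))"
      by (simp add: algebra_simps)
    also have "\<dots> \<le> exp (- (r * t / \<mu>)) * (t * norm (V 0) + C * norm (W 0))"
      using ept t C0 by (intro mult_right_mono) auto
    finally show ?thesis .
  qed
  show "exp (- \<mu>) * t * norm (V 0) - C * norm (W 0) \<le> norm (W t)" if rt: "r * t \<le> 1"
  proof -
    have "(- q) * t \<le> (\<mu> * r) * t" using qlo t by (rule mult_right_mono)
    also have "\<dots> \<le> \<mu>" using mult_left_mono[OF rt, of \<mu>] mu0 by (simp add: mult.assoc)
    finally have "exp (- \<mu>) \<le> exp (q * t)" by simp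
    then have "t * exp (- \<mu>) \<le> B" by (intro order_trans[OF mult_left_mono Blo] t)
    then have "exp (- \<mu>) * t * norm (V 0) \<le> B * norm (V 0)"
      by (intro mult_right_mono) (simp_all add: mult.commute)
    moreover have "\<bar>A\<bar> * norm (W 0) \<le> C * norm (W 0)"
    proof (rule mult_right_mono)
      have "exp (p * t) \<le> 1" using p0 t by (simp add: mult_nonpos_nonneg)
      then show "\<bar>A\<bar> \<le> C" using Ahi mult_left_mono[of "exp (p * t)" 1 C] C0 by simp
    qed simp
    moreover have "B * norm (V 0) - \<bar>A\<bar> * norm (W 0) \<le> norm (W t)"
      unfolding W using B0 norm_diff_ineq[of "B *\<^sub>R V 0" "A *\<^sub>R W 0"] by simp
    ultimately show ?thesis by linarith
  qed
qed

text \<open>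
  The energy \<open>\<bar>V\<bar>\<^sup>2 + r\<^sup>2 \<bar>W\<bar>\<^sup>2\<close> alone dissipates only through \<open>V\<close>.  Adding \<open>\<eta> V \<bullet> W\<close> produces the missing
  term \<open>- \<eta> r\<^sup>2 \<bar>W\<bar>\<^sup>2\<close> in the derivative.  The bound \<open>\<eta> \<le> \<delta> \<le> r\<close> keeps the perturbed energy comparable to
  the energy, and the bound by \<open>b0\<close> lets the damping absorb the cross terms.  Since \<open>b\<close> grows at most like
  \<open>\<mu> r\<close>, one \<open>\<eta>\<close> serves all frequencies.  Dividing by \<open>r\<^sup>2\<close> at the end leaves a bound in which the initial
  position has no weight in \<open>r\<close>.
\<close>
lemma damped_oscillator_decay:
  fixes W V :: "real \<Rightarrow> 'b::real_inner"
  assumes osc: "damped_oscillator b r W V" and delta: "\<delta> > 0" "\<delta> \<le> r" and b: "b0 \<le> b" "b \<le> \<mu> * r" and b0: "b0 > 0"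
    and eta: "\<eta> > 0" "\<eta> \<le> \<delta>" "\<eta> * (1 + \<mu>\<^sup>2 / 2) \<le> b0" and t: "t \<ge> 0"
  shows "(norm (W t))\<^sup>2 \<le> 3 * exp (- (\<eta> / 3 * t)) * ((norm (V 0))\<^sup>2 / \<delta>\<^sup>2 + (norm (W 0))\<^sup>2)"
proof -
  have r: "r > 0" using delta by simp
  have mu: "\<mu> \<ge> 0"
  proof -
    have "0 \<le> \<mu> * r" using b b0 by simp
    then show ?thesis using r by (simp add: zero_le_mult_iff)
  qed
  define F where "F s = (norm (V s))\<^sup>2 + r\<^sup>2 * (norm (W s))\<^sup>2" for s
  define E where "E s = F s + \<eta> * (V s \<bullet> W s)" for s
  have cross: "\<bar>\<eta> * (V s \<bullet> W s)\<bar> \<le> F s / 2" for s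
  proof -
    have "\<bar>\<eta> * (V s \<bullet> W s)\<bar> \<le> r * (norm (V s) * norm (W s))"
      unfolding abs_mult using eta delta Cauchy_Schwarz_ineq2[of "V s" "W s"] by (intro mult_mono) auto
    also have "\<dots> \<le> F s / 2"
      using zero_le_power2[of "norm (V s) - r * norm (W s)"]
      by (simp add: F_def power2_eq_square algebra_simps)
    finally show ?thesis .
  qed
  have Elo: "F s / 2 \<le> E s" and Ehi: "E s \<le> 3 / 2 * F s" for s
    using cross[of s] unfolding E_def abs_le_iff by linarith+
  define E' where "E' s = 2 * (V s \<bullet> - (b *\<^sub>R V s + r\<^sup>2 *\<^sub>R W s)) + 2 * r\<^sup>2 * (W s \<bullet> V s)
      + \<eta> * (V s \<bullet> V s + - (b *\<^sub>R V s + r\<^sup>2 *\<^sub>R W s) \<bullet> W s)" for s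
  have E'le: "E' s \<le> - (\<eta> / 3 * E s)" for s
  proof -
    have VV: "V s \<bullet> V s = (norm (V s))\<^sup>2" and WW: "W s \<bullet> W s = (norm (W s))\<^sup>2"
      by (simp_all add: power2_norm_eq_inner)
    have E'eq: "E' s = (\<eta> - 2 * b) * (norm (V s))\<^sup>2 - \<eta> * b * (V s \<bullet> W s) - \<eta> * r\<^sup>2 * (norm (W s))\<^sup>2"
      unfolding E'_def VV[symmetric] WW[symmetric]
      by (simp add: inner_add_left inner_add_right inner_commute[of "W s" "V s"] algebra_simps)
    have "- (b * (V s \<bullet> W s)) \<le> b * (norm (V s) * norm (W s))"
      unfolding mult_minus_right[symmetric]
      using b b0 Cauchy_Schwarz_ineq2[of "V s" "W s"] by (intro mult_left_mono) auto
    also have "\<dots> \<le> \<mu> * r * (norm (V s) * norm (W s))" using b by (intro mult_right_mono) auto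
    also have "\<dots> \<le> \<mu>\<^sup>2 / 2 * (norm (V s))\<^sup>2 + r\<^sup>2 / 2 * (norm (W s))\<^sup>2"
      using zero_le_power2[of "\<mu> * norm (V s) - r * norm (W s)"]
      by (simp add: power2_eq_square algebra_simps)
    finally have "\<eta> * - (b * (V s \<bullet> W s)) \<le> \<eta> * (\<mu>\<^sup>2 / 2 * (norm (V s))\<^sup>2 + r\<^sup>2 / 2 * (norm (W s))\<^sup>2)"
      using eta by (intro mult_left_mono) auto
    then have "E' s \<le> (\<eta> * (1 + \<mu>\<^sup>2 / 2) - 2 * b) * (norm (V s))\<^sup>2 - \<eta> / 2 * (r\<^sup>2 * (norm (W s))\<^sup>2)"
      unfolding E'eq by (simp add: algebra_simps)
    also have "\<dots> \<le> (- \<eta> / 2) * (norm (V s))\<^sup>2 - \<eta> / 2 * (r\<^sup>2 * (norm (W s))\<^sup>2)"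
    proof -
      have "\<eta> \<le> \<eta> * (1 + \<mu>\<^sup>2 / 2)" using eta by simp
      then have "\<eta> * (1 + \<mu>\<^sup>2 / 2) - 2 * b \<le> - \<eta> / 2" using eta b by linarith
      then show ?thesis by (intro diff_right_mono mult_right_mono) auto
    qed
    also have "\<dots> = - (\<eta> / 2 * F s)" by (simp add: F_def algebra_simps)
    also have "\<dots> \<le> - (\<eta> / 3 * E s)"
      using mult_left_mono[OF Ehi[of s], of "\<eta> / 3"] eta by simp
    finally show ?thesis .
  qed
  have Ederiv: "(E has_real_derivative E' s) (at s within {0..})" if "s \<ge> 0" for s
  proof -
    have W: "(W has_vector_derivative V s) (at s within {0..})"
      and V: "(V has_vector_derivative - (b *\<^sub>R V s + r\<^sup>2 *\<^sub>R W s)) (at s within {0..})"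
      using osc that by (auto simp: damped_oscillator_def)
    note inner = bounded_bilinear.has_vector_derivative[OF bounded_bilinear_inner]
    have Edef: "E = (\<lambda>s. V s \<bullet> V s + r\<^sup>2 * (W s \<bullet> W s) + \<eta> * (V s \<bullet> W s))"
      by (simp add: fun_eq_iff E_def F_def power2_norm_eq_inner)
    have "(E has_real_derivative ((V s \<bullet> - (b *\<^sub>R V s + r\<^sup>2 *\<^sub>R W s) + - (b *\<^sub>R V s + r\<^sup>2 *\<^sub>R W s) \<bullet> V s)
        + r\<^sup>2 * (W s \<bullet> V s + V s \<bullet> W s))
        + \<eta> * (V s \<bullet> V s + - (b *\<^sub>R V s + r\<^sup>2 *\<^sub>R W s) \<bullet> W s)) (at s within {0..})"
      unfolding Edef
      by (intro DERIV_add DERIV_cmult)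
         (use inner[OF V V] inner[OF W W] inner[OF V W] in \<open>simp_all only: has_real_derivative_iff_has_vector_derivative\<close>)
    then show ?thesis unfolding E'_def by (simp add: inner_commute algebra_simps)
  qed
  have "exp (\<eta> / 3 * t) * E t \<le> exp (\<eta> / 3 * 0) * E 0"
  proof (rule DERIV_nonpos_imp_decreasing_open[OF t])
    have der: "((\<lambda>s. exp (\<eta> / 3 * s) * E s) has_real_derivative
        exp (\<eta> / 3 * s) * (\<eta> / 3 * E s + E' s)) (at s within {0..})" if "s \<ge> 0" for s
      using Ederiv[OF that] by (auto intro!: derivative_eq_intros simp: algebra_simps)
    show "continuous_on {0..t} (\<lambda>s. exp (\<eta> / 3 * s) * E s)"
      by (rule continuous_on_subset[of "{0..}"], rule DERIV_continuous_on, rule der) auto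
    fix s assume s: "0 < s" "s < t"
    have "at s within {0..} = at s" using s by (intro at_within_interior) auto
    moreover have "exp (\<eta> / 3 * s) * (\<eta> / 3 * E s + E' s) \<le> 0"
      using E'le[of s] by (intro mult_nonneg_nonpos) auto
    ultimately show "\<exists>y. ((\<lambda>s. exp (\<eta> / 3 * s) * E s) has_real_derivative y) (at s) \<and> y \<le> 0"
      using der[of s] s by auto
  qed
  then have "exp (\<eta> / 3 * t) * E t \<le> E 0" by simp
  then have "exp (- (\<eta> / 3 * t)) * (exp (\<eta> / 3 * t) * E t) \<le> exp (- (\<eta> / 3 * t)) * E 0"
    by (intro mult_left_mono) auto
  then have Et: "E t \<le> exp (- (\<eta> / 3 * t)) * E 0"
    by (simp add: mult.assoc[symmetric] exp_add[symmetric])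
  have "r\<^sup>2 * (norm (W t))\<^sup>2 \<le> F t" by (simp add: F_def)
  also have "\<dots> \<le> 2 * E t" using Elo[of t] by simp
  also have "\<dots> \<le> 2 * (exp (- (\<eta> / 3 * t)) * E 0)" using Et by simp
  also have "\<dots> \<le> 2 * (exp (- (\<eta> / 3 * t)) * (3 / 2 * F 0))"
    using Ehi[of 0] by (intro mult_left_mono) auto
  finally have "(norm (W t))\<^sup>2 \<le> 3 * exp (- (\<eta> / 3 * t)) * ((norm (V 0))\<^sup>2 / r\<^sup>2 + (norm (W 0))\<^sup>2)"
    using r by (simp add: F_def field_simps)
  also have "\<dots> \<le> 3 * exp (- (\<eta> / 3 * t)) * ((norm (V 0))\<^sup>2 / \<delta>\<^sup>2 + (norm (W 0))\<^sup>2)"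
    using delta by (intro mult_left_mono add_right_mono divide_left_mono power_mono mult_pos_pos) auto
  finally show ?thesis .
qed

text \<open>
  The inequality \<open>ln (1 + r) \<ge> r - r\<^sup>2\<close> leaves \<open>\<mu> (1 - r) r\<close>, and the threshold for \<open>r\<close> is exactly where
  \<open>\<mu> (1 - r)\<close> has dropped to \<open>(\<mu> + 2) / 2\<close>, the midpoint between \<open>\<mu>\<close> and the critical value \<open>2\<close>.
\<close>
lemma log_damping_bounds:
  fixes \<mu> r :: real
  assumes mu: "\<mu> > 2" and r: "0 \<le> r" "r \<le> (\<mu> - 2) / (2 * \<mu>)"
  shows "(\<mu> + 2) / 2 * r \<le> \<mu> * ln (1 + r)"
proof -
  have "(\<mu> - 2) / (2 * \<mu>) \<le> 1" using mu by (simp add: field_simps)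
  then have "r - r\<^sup>2 \<le> ln (1 + r)" using r by (intro ln_one_plus_pos_lower_bound) auto
  then have "\<mu> * (r - r\<^sup>2) \<le> \<mu> * ln (1 + r)" using mu by (intro mult_left_mono) auto
  moreover have "(\<mu> + 2) / 2 * r \<le> \<mu> * (r - r\<^sup>2)"
  proof -
    have "2 * \<mu> * r \<le> \<mu> - 2" using r mu by (simp add: field_simps)
    then have "(2 * \<mu> * r) * r \<le> (\<mu> - 2) * r" using r by (intro mult_right_mono)
    then have h: "2 * (\<mu> * r\<^sup>2) \<le> \<mu> * r - 2 * r"
      by (simp add: power2_eq_square left_diff_distrib mult.assoc mult.left_commute)
    have "2 * (\<mu> * (r - r\<^sup>2)) = 2 * (\<mu> * r) - 2 * (\<mu> * r\<^sup>2)" by (simp add: right_diff_distrib)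
    then have "(\<mu> + 2) * r \<le> 2 * (\<mu> * (r - r\<^sup>2))" using h by (simp add: distrib_right)
    then show ?thesis by simp
  qed
  ultimately show ?thesis by linarith
qed

section \<open>Integration over the frequencies\<close>

lemma nn_integral_exp_abs_finite:
  assumes a: "a > 0"
  shows "(\<integral>\<^sup>+s. ennreal (exp (- (a * \<bar>s\<bar>))) \<partial>lborel) < \<infinity>"
proof -
  \<comment> \<open>The two-sided exponential is, up to the factor a, a sum of two reflected exponential densities.\<close>
  let ?e = "\<lambda>s. ennreal (exponential_density a s)"
  have one: "(\<integral>\<^sup>+s. ?e s \<partial>lborel) = 1"
    using prob_space.emeasure_space_1[OF prob_space_exponential_density[OF a]]
    by (simp add: emeasure_density)
  have refl: "(\<integral>\<^sup>+s. ?e (- s) \<partial>lborel) = 1"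
    using nn_integral_lborel_affine[of ?e "-1" 0] one by simp
  have "(\<integral>\<^sup>+s. ennreal (exp (- (a * \<bar>s\<bar>))) \<partial>lborel)
      \<le> (\<integral>\<^sup>+s. ennreal (1 / a) * (?e s + ?e (- s)) \<partial>lborel)"
  proof (rule nn_integral_mono)
    fix s :: real
    have "exp (- (a * \<bar>s\<bar>)) \<le> (1 / a) * (exponential_density a s + exponential_density a (- s))"
      using a by (auto simp: exponential_density_def field_simps)
    then show "ennreal (exp (- (a * \<bar>s\<bar>))) \<le> ennreal (1 / a) * (?e s + ?e (- s))"
      using a by (simp add: ennreal_mult[symmetric] ennreal_plus[symmetric] exponential_density_nonneg ennreal_leI del: ennreal_plus)
  qed
  also have "\<dots> = ennreal (1 / a) * (1 + 1)"
    by (subst nn_integral_cmult) (simp_all add: nn_integral_add one refl)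
  also have "\<dots> < \<infinity>" by (simp add: ennreal_mult_less_top)
  finally show ?thesis .
qed

text \<open>
  Since \<open>\<Sum>\<^sub>b \<bar>x \<bullet> b\<bar> \<le> n \<bar>x\<bar>\<close>, the integrand is dominated by a product of one-dimensional exponentials.
\<close>
lemma nn_integral_exp_norm_finite:
  assumes c: "c > 0"
  shows "(\<integral>\<^sup>+x. ennreal (exp (- (c * norm (x::'a::euclidean_space)))) \<partial>lborel) < \<infinity>"
proof -
  define a where "a = c / DIM('a)"
  have a: "a > 0" using c by (simp add: a_def)
  have "(\<integral>\<^sup>+x. ennreal (exp (- (c * norm (x::'a)))) \<partial>lborel)
      \<le> (\<integral>\<^sup>+x. (\<Prod>b\<in>Basis. ennreal (exp (- (a * \<bar>x \<bullet> b\<bar>)))) \<partial>(lborel :: 'a measure))"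
  proof (rule nn_integral_mono)
    fix x :: 'a
    have "(\<Sum>b\<in>Basis. \<bar>x \<bullet> b\<bar>) \<le> (\<Sum>b\<in>(Basis::'a set). norm x)"
      by (intro sum_mono) (simp add: Basis_le_norm)
    then have "a * (\<Sum>b\<in>Basis. \<bar>x \<bullet> b\<bar>) \<le> a * (DIM('a) * norm x)"
      using a by (intro mult_left_mono) auto
    also have "\<dots> = c * norm x" by (simp add: a_def)
    finally have "exp (- (c * norm x)) \<le> exp (\<Sum>b\<in>Basis. - (a * \<bar>x \<bullet> b\<bar>))"
      by (simp add: sum_negf sum_distrib_left)
    also have "\<dots> = (\<Prod>b\<in>Basis. exp (- (a * \<bar>x \<bullet> b\<bar>)))" by (simp add: exp_sum)
    finally show "ennreal (exp (- (c * norm x))) \<le> (\<Prod>b\<in>Basis. ennreal (exp (- (a * \<bar>x \<bullet> b\<bar>))))"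
      by (simp add: prod_ennreal ennreal_leI)
  qed
  also have "\<dots> = (\<Prod>b\<in>(Basis::'a set). (\<integral>\<^sup>+s. ennreal (exp (- (a * \<bar>s\<bar>))) \<partial>lborel))"
    by (subst nn_integral_lborel_prod[where f = "\<lambda>_ s. ennreal (exp (- (a * \<bar>s\<bar>)))"]) auto
  also have "\<dots> < \<infinity>"
    using nn_integral_exp_abs_finite[OF a] by (simp add: power_less_top_ennreal)
  finally show ?thesis .
qed

text \<open>
  This scaling is the source of the factor \<open>1 / t\<^sup>n\<close> in the upper bound.
\<close>
lemma nn_integral_exp_norm_decay:
  assumes c: "c > 0"
  shows "\<exists>K\<ge>0. \<forall>t>0. (\<integral>\<^sup>+x. ennreal (exp (- (c * (t * norm (x::'a::euclidean_space))))) \<partial>lborel)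
            = ennreal (K / t ^ DIM('a))"
proof -
  let ?I = "\<integral>\<^sup>+x. ennreal (exp (- (c * norm (x::'a)))) \<partial>lborel"
  define K where "K = enn2real ?I"
  have K0: "K \<ge> 0" by (simp add: K_def)
  have K: "?I = ennreal K" using nn_integral_exp_norm_finite[OF c, where 'a='a] by (simp add: K_def)
  have "(\<integral>\<^sup>+x. ennreal (exp (- (c * (t * norm (x::'a))))) \<partial>lborel) = ennreal (K / t ^ DIM('a))" if t: "t > 0" for t
  proof -
    have "(\<integral>\<^sup>+x. ennreal (exp (- (c * (t * norm (x::'a))))) \<partial>lborel) = ennreal ((1 / t) ^ DIM('a)) * ?I"
      using t nn_integral_lborel_affine[of "\<lambda>x::'a. ennreal (exp (- (c * (t * norm x))))" "1 / t" 0] by simp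
    then show ?thesis using t using K0 by (simp add: K ennreal_mult[symmetric] power_divide)
  qed
  with K0 show ?thesis by blast
qed

lemma low_frequency_bounds:
  fixes W V :: "real \<Rightarrow> 'b::real_normed_vector"
  assumes mu: "\<mu> > 2"
  defines "C \<equiv> \<mu> / sqrt (((\<mu> + 2) / 2)\<^sup>2 - 4)"
  assumes osc: "damped_oscillator (\<mu> * ln (1 + r)) r W V"
    and r: "0 < r" "r \<le> (\<mu> - 2) / (2 * \<mu>)" and t: "t \<ge> 0"
  shows "norm (W t) \<le> exp (- (r * t / \<mu>)) * (t * norm (V 0) + C * norm (W 0))"
    and "r * t \<le> 1 \<Longrightarrow> exp (- \<mu>) * t * norm (V 0) - C * norm (W 0) \<le> norm (W t)"
proof -
  have kappa: "(\<mu> + 2) / 2 > 2" using mu by simp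
  have lo: "(\<mu> + 2) / 2 * r \<le> \<mu> * ln (1 + r)" using log_damping_bounds[OF mu] r by simp
  have hi: "\<mu> * ln (1 + r) \<le> \<mu> * r" using mu r ln_add_one_self_le_self[of r] by simp
  show "norm (W t) \<le> exp (- (r * t / \<mu>)) * (t * norm (V 0) + C * norm (W 0))"
    and "r * t \<le> 1 \<Longrightarrow> exp (- \<mu>) * t * norm (V 0) - C * norm (W 0) \<le> norm (W t)"
    using overdamped_bounds[OF osc r(1) kappa lo hi t] unfolding C_def by blast+
qed

lemma high_frequency_decay:
  fixes \<mu> \<delta> :: real
  assumes mu: "\<mu> > 0" and delta: "\<delta> > 0"
  shows "\<exists>a>0. \<forall>r (W::real \<Rightarrow> 'b::real_inner) V t. \<delta> \<le> r \<longrightarrow> damped_oscillator (\<mu> * ln (1 + r)) r W V \<longrightarrow> t \<ge> 0 \<longrightarrow>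
     (norm (W t))\<^sup>2 \<le> 3 * exp (- (a * t)) * ((norm (V 0))\<^sup>2 / \<delta>\<^sup>2 + (norm (W 0))\<^sup>2)"
proof -
  define b0 where "b0 = \<mu> * ln (1 + \<delta>)"
  have b0: "b0 > 0" using mu delta by (simp add: b0_def)
  define \<eta> where "\<eta> = min \<delta> (b0 / (1 + \<mu>\<^sup>2 / 2))"
  have pos: "1 + \<mu>\<^sup>2 / 2 > 0" by (intro add_pos_nonneg) auto
  have eta: "\<eta> > 0" "\<eta> \<le> \<delta>" using b0 delta pos by (simp_all add: \<eta>_def)
  have "\<eta> \<le> b0 / (1 + \<mu>\<^sup>2 / 2)" by (simp add: \<eta>_def)
  then have eta3: "\<eta> * (1 + \<mu>\<^sup>2 / 2) \<le> b0" using pos by (simp only: pos_le_divide_eq)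
  have "(norm (W t))\<^sup>2 \<le> 3 * exp (- (\<eta> / 3 * t)) * ((norm (V 0))\<^sup>2 / \<delta>\<^sup>2 + (norm (W 0))\<^sup>2)"
    if r: "\<delta> \<le> r" and osc: "damped_oscillator (\<mu> * ln (1 + r)) r W V" and t: "t \<ge> 0"
    for r t and W V :: "real \<Rightarrow> 'b"
  proof (rule damped_oscillator_decay[OF osc delta r _ _ b0 eta eta3 t])
    show "b0 \<le> \<mu> * ln (1 + r)" using mu delta r by (simp add: b0_def)
    show "\<mu> * ln (1 + r) \<le> \<mu> * r" using mu delta r ln_add_one_self_le_self[of r] by simp
  qed
  then show ?thesis using eta(1) by (intro exI[of _ "\<eta> / 3"]) auto
qed

lemma exp_decay_le_power:
  fixes a t :: real
  assumes "a > 0" "t > 0" "n \<ge> 1"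
  shows "exp (- (a * t)) \<le> (real n / a) ^ n / t ^ n"
proof -
  have "(a * t / real n) ^ n \<le> (1 + a * t / real n) ^ n"
    using assms by (intro power_mono) auto
  also have "\<dots> \<le> exp (a * t)"
    using assms mult_pos_pos[of a t] by (intro exp_ge_one_plus_x_over_n_power_n) (auto intro: order_trans[of _ 0])
  finally have "exp (- (a * t)) \<le> inverse ((a * t / real n) ^ n)"
    using assms unfolding exp_minus by (intro le_imp_inverse_le) auto
  also have "\<dots> = (real n / a) ^ n / t ^ n"
    using assms by (simp add: power_divide power_mult_distrib field_simps)
  finally show ?thesis .
qed

lemma powr_rate_square:
  assumes "t > 0"
  shows "(t powr (1 - real n / 2))\<^sup>2 = t\<^sup>2 / t ^ n"
proof -
  have "(t powr (1 - real n / 2))\<^sup>2 = t powr (2 - real n)"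
    by (simp add: power2_eq_square powr_add[symmetric])
  then show ?thesis using assms by (simp add: powr_diff powr_realpow powr_numeral)
qed

text \<open>
  The frequency \<open>0\<close>, a null set, is excluded because the two characteristic roots coincide there.  The
  data are evaluated by the absolutely convergent transforms, which can be bounded pointwise.
\<close>
definition frequency_solution ::
    "real \<Rightarrow> ('a::euclidean_space \<Rightarrow> complex) \<Rightarrow> ('a \<Rightarrow> complex) \<Rightarrow> (real \<Rightarrow> 'a \<Rightarrow> complex) \<Rightarrow> (real \<Rightarrow> 'a \<Rightarrow> complex) \<Rightarrow> bool" where
  "frequency_solution \<mu> u0 u1 w v \<longleftrightarrow> (AE \<xi> in lborel. \<xi> \<noteq> 0 \<and>
     damped_oscillator (\<mu> * ln (1 + norm \<xi>)) (norm \<xi>) (\<lambda>t. w t \<xi>) (\<lambda>t. v t \<xi>) \<and>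
     w 0 \<xi> = fourier u0 \<xi> \<and> v 0 \<xi> = fourier u1 \<xi>)"

lemma mild_solution_frequency:
  fixes u0 u1 :: "'a::euclidean_space \<Rightarrow> complex"
  assumes u: "mild_solution \<mu> u0 u1 u" and u0: "integrable lborel u0" and u1: "integrable lborel u1"
  obtains w v where "\<And>t. t \<ge> 0 \<Longrightarrow> has_L2_fourier (u t) (w t)" "has_L2_fourier u0 (w 0)"
    "has_L2_fourier u1 (v 0)" "frequency_solution \<mu> u0 u1 w v"
proof -
  from u obtain w v where F: "\<forall>t\<ge>0. has_L2_fourier (u t) (w t)" "has_L2_fourier u0 (w 0)" "has_L2_fourier u1 (v 0)"
    and ode: "AE \<xi> in lborel. \<forall>t\<ge>0.
           ((\<lambda>s. w s \<xi>) has_vector_derivative v t \<xi>) (at t within {0..}) \<and>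
           ((\<lambda>s. v s \<xi>) has_vector_derivative
              - ((\<mu> * log_symbol \<xi>) *\<^sub>R v t \<xi> + (norm \<xi>)\<^sup>2 *\<^sub>R w t \<xi>)) (at t within {0..})"
    unfolding mild_solution_def by blast
  have "AE \<xi> in lborel. \<xi> \<noteq> (0::'a)" by (rule AE_lborel_singleton)
  with ode has_L2_fourier_eq_fourier[OF u0 F(2)] has_L2_fourier_eq_fourier[OF u1 F(3)]
  have "frequency_solution \<mu> u0 u1 w v"
    unfolding frequency_solution_def damped_oscillator_def log_symbol_def by eventually_elim blast
  with F that show thesis by blast
qed

section \<open>Upper and lower bounds for solutions\<close>

text \<open>
  Each frequency obeys the low- or the high-frequency estimate, hence the sum of both majorants.  The
  first integrates to a multiple of \<open>t\<^sup>2 / t\<^sup>n\<close>, the second decays exponentially and is therefore at most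
  a multiple of \<open>1 / t\<^sup>n \<le> t\<^sup>2 / t\<^sup>n\<close> for \<open>t \<ge> 1\<close>.
\<close>
lemma mild_solution_upper_bound:
  fixes \<mu> :: real
  assumes mu: "\<mu> > 2"
  shows "\<exists>C2>0. \<forall>(u0 :: 'a::euclidean_space \<Rightarrow> complex) u1 u t.
     u0 \<in> L1_space \<longrightarrow> u1 \<in> L11_space \<longrightarrow> mild_solution \<mu> u0 u1 u \<longrightarrow> t \<ge> 1 \<longrightarrow>
     norm_L2 (u t) \<le> C2 * (norm_L2 u0 + norm_L1 u0 + norm_L2 u1 + norm_L11 u1) * t powr (1 - real DIM('a) / 2)"
proof -
  let ?n = "DIM('a)"
  define \<delta> where "\<delta> = (\<mu> - 2) / (2 * \<mu>)"
  have delta: "\<delta> > 0" using mu by (simp add: \<delta>_def)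
  define C where "C = \<mu> / sqrt (((\<mu> + 2) / 2)\<^sup>2 - 4)"
  have "((\<mu> + 2) / 2)\<^sup>2 > 2\<^sup>2" using mu by (intro power_strict_mono) auto
  then have C: "C \<ge> 0" using mu by (simp add: C_def)
  obtain a where a: "a > 0" and high: "\<And>r (W::real \<Rightarrow> complex) V t. \<delta> \<le> r \<Longrightarrow> damped_oscillator (\<mu> * ln (1 + r)) r W V \<Longrightarrow> t \<ge> 0 \<Longrightarrow>
     (norm (W t))\<^sup>2 \<le> 3 * exp (- (a * t)) * ((norm (V 0))\<^sup>2 / \<delta>\<^sup>2 + (norm (W 0))\<^sup>2)"
    using high_frequency_decay[of \<mu> \<delta>, where 'b=complex] mu delta by auto
  obtain K where K: "K \<ge> 0" and int: "\<And>t. t > 0 \<Longrightarrow>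
      (\<integral>\<^sup>+x. ennreal (exp (- ((2 / \<mu>) * (t * norm (x::'a))))) \<partial>lborel) = ennreal (K / t ^ ?n)"
    using nn_integral_exp_norm_decay[of "2 / \<mu>", where 'a='a] mu by auto
  define c where "c = (2 * pi) ^ ?n"
  have c: "c > 0" by (simp add: c_def)
  define A where "A = (real ?n / a) ^ ?n"
  have A: "A > 0" using a by (simp add: A_def)
  \<comment> \<open>The first summand collects the low-frequency majorant, the second the high-frequency one.\<close>
  define Q where "Q = (1 + C)\<^sup>2 * K / c + 3 * A * (1 / \<delta>\<^sup>2 + 1)"
  have Q: "Q > 0" unfolding Q_def using K c A delta by (intro add_nonneg_pos mult_pos_pos divide_nonneg_pos) (auto intro: add_nonneg_pos)
  have main: "norm_L2 (u t) \<le> sqrt Q * (norm_L2 u0 + norm_L1 u0 + norm_L2 u1 + norm_L11 u1) * t powr (1 - real ?n / 2)"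
    if u0: "u0 \<in> L1_space" and u1: "u1 \<in> L11_space" and u: "mild_solution \<mu> u0 u1 u" and t: "t \<ge> 1"
    for u0 u1 :: "'a \<Rightarrow> complex" and u t
  proof -
    have u0i: "integrable lborel u0" and u1i: "integrable lborel u1"
      using u0 u1 by (simp_all add: L1_space_def L11_space_def)
    obtain w v where F: "\<And>t. t \<ge> 0 \<Longrightarrow> has_L2_fourier (u t) (w t)" "has_L2_fourier u0 (w 0)" "has_L2_fourier u1 (v 0)"
      and freq: "frequency_solution \<mu> u0 u1 w v"
      using mild_solution_frequency[OF u u0i u1i] by blast
    define N0 N1 S where "N0 = norm_L1 u0" and "N1 = norm_L11 u1"
      and "S = norm_L2 u0 + norm_L1 u0 + norm_L2 u1 + norm_L11 u1"
    have N: "N0 \<ge> 0" "N1 \<ge> 0" by (simp_all add: N0_def N1_def norm_L1_def norm_L11_def)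
    define M where "M = N1 + C * N0"
    have M0: "M \<ge> 0" using N C by (simp add: M_def)
    let ?low = "\<lambda>\<xi>::'a. t\<^sup>2 * M\<^sup>2 * exp (- ((2 / \<mu>) * (t * norm \<xi>)))"
    let ?high = "\<lambda>\<xi>. 3 * exp (- (a * t)) * ((norm (v 0 \<xi>))\<^sup>2 / \<delta>\<^sup>2 + (norm (w 0 \<xi>))\<^sup>2)"
    have pointwise: "AE \<xi> in lborel. (norm (w t \<xi>))\<^sup>2 \<le> ?low \<xi> + ?high \<xi>"
      using freq unfolding frequency_solution_def
    proof eventually_elim
      case (elim \<xi>)
      then have xi: "norm \<xi> > 0" and osc: "damped_oscillator (\<mu> * ln (1 + norm \<xi>)) (norm \<xi>) (\<lambda>t. w t \<xi>) (\<lambda>t. v t \<xi>)"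
        and w0: "w 0 \<xi> = fourier u0 \<xi>" and v0: "v 0 \<xi> = fourier u1 \<xi>" by auto
      show ?case
      proof (cases "norm \<xi> \<le> \<delta>")
        case True
        have "norm (w t \<xi>) \<le> exp (- (norm \<xi> * t / \<mu>)) * (t * norm (v 0 \<xi>) + C * norm (w 0 \<xi>))"
          unfolding C_def using low_frequency_bounds(1)[OF mu osc xi] True t by (simp add: \<delta>_def)
        also have "t * norm (v 0 \<xi>) + C * norm (w 0 \<xi>) \<le> t * N1 + C * N0"
          using norm_fourier_le[of u1 \<xi>] norm_fourier_le[of u0 \<xi>] norm_L1_le_L11[OF u1] t C
          unfolding w0 v0 N0_def N1_def by (intro add_mono mult_left_mono) (auto simp: norm_L1_def)
        also have "\<dots> \<le> t * M"
          using mult_right_mono[OF t, of "C * N0"] C N by (simp add: M_def distrib_left)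
        finally have "norm (w t \<xi>) \<le> exp (- (norm \<xi> * t / \<mu>)) * (t * M)" by simp
        then have "(norm (w t \<xi>))\<^sup>2 \<le> (exp (- (norm \<xi> * t / \<mu>)) * (t * M))\<^sup>2"
          by (intro power_mono) auto
        also have "\<dots> = ?low \<xi>"
          by (simp add: power_mult_distrib exp_double[symmetric] mult_ac)
        also have "\<dots> \<le> ?low \<xi> + ?high \<xi>" by simp
        finally show ?thesis .
      next
        case False
        have "(norm (w t \<xi>))\<^sup>2 \<le> ?high \<xi>" using high[OF _ osc, of t] False t by simp
        also have "\<dots> \<le> ?low \<xi> + ?high \<xi>" by simp
        finally show ?thesis .
      qed
    qed
    have L2: "u t \<in> L2_space" "w t \<in> L2_space" "w 0 \<in> L2_space" "v 0 \<in> L2_space"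
      using F(1)[of t] F(2,3) t by (auto simp: has_L2_fourier_def)
    note [measurable] = L2(2-4)[THEN L2_space_sq_norm(1)]
    have "sq_norm (w t) \<le> (\<integral>\<^sup>+\<xi>. ennreal (t\<^sup>2 * M\<^sup>2) * ennreal (exp (- ((2 / \<mu>) * (t * norm \<xi>))))
        + ennreal (3 * exp (- (a * t))) * (ennreal (1 / \<delta>\<^sup>2) * ennreal ((norm (v 0 \<xi>))\<^sup>2) + ennreal ((norm (w 0 \<xi>))\<^sup>2)) \<partial>lborel)"
      unfolding sq_norm_def
    proof (rule nn_integral_mono_AE)
      show "AE \<xi> in lborel. ennreal ((norm (w t \<xi>))\<^sup>2) \<le> ennreal (t\<^sup>2 * M\<^sup>2) * ennreal (exp (- ((2 / \<mu>) * (t * norm \<xi>))))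
        + ennreal (3 * exp (- (a * t))) * (ennreal (1 / \<delta>\<^sup>2) * ennreal ((norm (v 0 \<xi>))\<^sup>2) + ennreal ((norm (w 0 \<xi>))\<^sup>2))"
        using pointwise
        by eventually_elim (simp add: ennreal_mult[symmetric] ennreal_plus[symmetric] ennreal_leI del: ennreal_plus)
    qed
    also have "\<dots> = ennreal (t\<^sup>2 * M\<^sup>2) * ennreal (K / t ^ ?n)
        + ennreal (3 * exp (- (a * t))) * (ennreal (1 / \<delta>\<^sup>2) * sq_norm (v 0) + sq_norm (w 0))"
      unfolding sq_norm_def int[of t, symmetric, OF less_le_trans[OF zero_less_one t]]
      by (simp add: nn_integral_add nn_integral_cmult)
    also have "\<dots> = ennreal (t\<^sup>2 * M\<^sup>2 * (K / t ^ ?n)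
        + 3 * exp (- (a * t)) * (1 / \<delta>\<^sup>2 * (norm_L2 (v 0))\<^sup>2 + (norm_L2 (w 0))\<^sup>2))"
      unfolding L2_space_sq_norm(3)[OF L2(3)] L2_space_sq_norm(3)[OF L2(4)] using K t
      by (simp add: ennreal_mult[symmetric] ennreal_plus[symmetric] del: ennreal_plus)
    finally have "(norm_L2 (w t))\<^sup>2 \<le> t\<^sup>2 * M\<^sup>2 * (K / t ^ ?n)
        + 3 * exp (- (a * t)) * (1 / \<delta>\<^sup>2 * (norm_L2 (v 0))\<^sup>2 + (norm_L2 (w 0))\<^sup>2)"
      unfolding L2_space_sq_norm(3)[OF L2(2)] using K t by (subst (asm) ennreal_le_iff) auto
    then have "c * (norm_L2 (u t))\<^sup>2 \<le> t\<^sup>2 * M\<^sup>2 * (K / t ^ ?n)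
        + 3 * exp (- (a * t)) * (1 / \<delta>\<^sup>2 * (c * (norm_L2 u1)\<^sup>2) + c * (norm_L2 u0)\<^sup>2)"
      using norm_L2_fourier[OF F(1), of t] norm_L2_fourier[OF F(2)] norm_L2_fourier[OF F(3)] t
      by (simp add: c_def)
    also have "\<dots> = c * (t\<^sup>2 / t ^ ?n * (M\<^sup>2 * K / c) + 3 * exp (- (a * t)) * (1 / \<delta>\<^sup>2 * (norm_L2 u1)\<^sup>2 + (norm_L2 u0)\<^sup>2))"
      using c by (simp add: algebra_simps)
    finally have "(norm_L2 (u t))\<^sup>2 \<le> t\<^sup>2 / t ^ ?n * (M\<^sup>2 * K / c)
        + 3 * exp (- (a * t)) * (1 / \<delta>\<^sup>2 * (norm_L2 u1)\<^sup>2 + (norm_L2 u0)\<^sup>2)"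
      using c by (simp only: mult_le_cancel_left_pos)
    also have "\<dots> \<le> t\<^sup>2 / t ^ ?n * ((1 + C)\<^sup>2 * S\<^sup>2 * K / c) + 3 * (t\<^sup>2 / t ^ ?n * A) * (1 / \<delta>\<^sup>2 * S\<^sup>2 + S\<^sup>2)"
    proof (intro add_mono mult_mono mult_left_mono divide_right_mono mult_right_mono)
      have S: "N0 \<le> S" "N1 \<le> S" "norm_L2 u0 \<le> S" "norm_L2 u1 \<le> S"
        using N unfolding S_def N0_def N1_def by (simp_all add: add_nonneg_nonneg)
      show "(norm_L2 u1)\<^sup>2 \<le> S\<^sup>2" "(norm_L2 u0)\<^sup>2 \<le> S\<^sup>2" using S by (auto intro: power_mono)
      have "M \<le> (1 + C) * S" unfolding M_def using S C by (simp add: distrib_right add_mono mult_left_mono)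
      then show "M\<^sup>2 \<le> (1 + C)\<^sup>2 * S\<^sup>2" using M0 by (simp add: power_mult_distrib[symmetric] power_mono)
      have "exp (- (a * t)) \<le> A / t ^ ?n"
        unfolding A_def using a t by (intro exp_decay_le_power) (auto simp: Suc_leI)
      also have "\<dots> \<le> t\<^sup>2 * (A / t ^ ?n)"
        using A t mult_right_mono[of 1 "t\<^sup>2" "A / t ^ ?n"] one_le_power[OF t, of 2] by simp
      finally show "exp (- (a * t)) \<le> t\<^sup>2 / t ^ ?n * A" by simp
    qed (use K c t A in \<open>auto intro!: add_nonneg_nonneg\<close>)
    also have "\<dots> = Q * S\<^sup>2 * (t\<^sup>2 / t ^ ?n)"
      unfolding Q_def by (simp add: algebra_simps add_divide_distrib)
    also have "\<dots> = (sqrt Q * S * t powr (1 - real ?n / 2))\<^sup>2"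
      using Q t by (simp add: power_mult_distrib powr_rate_square)
    finally have "(norm_L2 (u t))\<^sup>2 \<le> (sqrt Q * S * t powr (1 - real ?n / 2))\<^sup>2" .
    then show ?thesis
      unfolding S_def[symmetric]
    proof (rule power2_le_imp_le)
      have "S \<ge> 0" using N by (simp add: S_def N0_def N1_def)
      then show "0 \<le> sqrt Q * S * t powr (1 - real ?n / 2)" using Q by simp
    qed
  qed
  show ?thesis
    using main Q by (intro exI[of _ "sqrt Q"]) auto
qed

text \<open>
  Restricting to the ball of radius \<open>1 / t\<close>, it is enough to bound \<open>\<bar>w t \<xi>\<bar>\<close> below there.  Its leading
  part is \<open>2 m = exp (- \<mu>) t \<bar>P\<bar>\<close>, and the errors from the variation of the transform of \<open>u1\<close> and from
  \<open>u0\<close> add up to at most \<open>R\<close>, so that \<open>R \<le> m\<close> once \<open>t \<ge> t0\<close>.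
\<close>
lemma mild_solution_lower_bound:
  fixes \<mu> :: real
  assumes mu: "\<mu> > 2"
  shows "\<exists>C1>0. \<forall>(u0 :: 'a::euclidean_space \<Rightarrow> complex) u1 u.
     u0 \<in> L1_space \<longrightarrow> u1 \<in> L11_space \<longrightarrow> mild_solution \<mu> u0 u1 u \<longrightarrow>
     (\<exists>t0>0. \<forall>t\<ge>t0. C1 * cmod (LINT x|lborel. u1 x) * t powr (1 - real DIM('a) / 2) \<le> norm_L2 (u t))"
proof -
  let ?n = "DIM('a)"
  define \<delta> where "\<delta> = (\<mu> - 2) / (2 * \<mu>)"
  have delta: "\<delta> > 0" using mu by (simp add: \<delta>_def)
  define C where "C = \<mu> / sqrt (((\<mu> + 2) / 2)\<^sup>2 - 4)"
  have "((\<mu> + 2) / 2)\<^sup>2 > 2\<^sup>2" using mu by (intro power_strict_mono) auto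
  then have C: "C \<ge> 0" using mu by (simp add: C_def)
  define c where "c = (2 * pi) ^ ?n"
  have c: "c > 0" by (simp add: c_def)
  define \<beta> where "\<beta> = unit_ball_vol (real ?n)"
  have beta: "\<beta> > 0" by (simp add: \<beta>_def)
  define C1 where "C1 = exp (- \<mu>) / 2 * sqrt (\<beta> / c)"
  have C1: "C1 > 0" using beta c by (simp add: C1_def)
  have main: "\<exists>t0>0. \<forall>t\<ge>t0. C1 * cmod (LINT x|lborel. u1 x) * t powr (1 - real ?n / 2) \<le> norm_L2 (u t)"
    if u0: "u0 \<in> L1_space" and u1: "u1 \<in> L11_space" and u: "mild_solution \<mu> u0 u1 u"
    for u0 u1 :: "'a \<Rightarrow> complex" and u
  proof -
    have u0i: "integrable lborel u0" and u1i: "integrable lborel u1"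
      using u0 u1 by (simp_all add: L1_space_def L11_space_def)
    obtain w v where F: "\<And>t. t \<ge> 0 \<Longrightarrow> has_L2_fourier (u t) (w t)" "has_L2_fourier u0 (w 0)" "has_L2_fourier u1 (v 0)"
      and freq: "frequency_solution \<mu> u0 u1 w v"
      using mild_solution_frequency[OF u u0i u1i] by blast
    define P where "P = (LINT x|lborel. u1 x)"
    define N0 N1 where "N0 = norm_L1 u0" and "N1 = norm_L11 u1"
    have N: "N0 \<ge> 0" "N1 \<ge> 0" by (simp_all add: N0_def N1_def norm_L1_def norm_L11_def)
    define R where "R = N1 + C * N0"
    have R0: "R \<ge> 0" using N C by (simp add: R_def)
    \<comment> \<open>The first term puts the ball inside the overdamped region, the second makes R at most m.
      For P = 0 the quotient is 0 by convention, and the claimed bound is then trivial.\<close>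
    define t0 where "t0 = 1 / \<delta> + 2 * exp \<mu> * R / cmod P"
    have t0: "t0 > 0" using delta R0 by (simp add: t0_def add_pos_nonneg)
    have "C1 * cmod P * t powr (1 - real ?n / 2) \<le> norm_L2 (u t)" if tt: "t \<ge> t0" for t
    proof (cases "P = 0")
      case False
      have t: "t > 0" using t0 tt by simp
      have td: "1 / t \<le> \<delta>"
      proof -
        have "1 / \<delta> \<le> t0" using R0 by (simp add: t0_def)
        then have "1 / \<delta> \<le> t" using tt by simp
        then show ?thesis using t delta by (simp add: field_simps)
      qed
      have tR: "R \<le> exp (- \<mu>) / 2 * t * cmod P"
      proof -
        have "2 * exp \<mu> * R / cmod P \<le> t0" using delta by (simp add: t0_def)
        then have "2 * exp \<mu> * R / cmod P \<le> t" using tt by simp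
        then have "2 * exp \<mu> * R \<le> t * cmod P" using False by (simp add: field_simps)
        then have "(exp (- \<mu>) / 2) * (2 * exp \<mu> * R) \<le> (exp (- \<mu>) / 2) * (t * cmod P)"
          by (intro mult_left_mono) auto
        then show ?thesis by (simp add: exp_minus mult_ac)
      qed
      define m where "m = exp (- \<mu>) / 2 * t * cmod P"
      have m0: "m \<ge> 0" using t by (simp add: m_def)
      have pointwise: "AE \<xi> in lborel. \<xi> \<in> cball 0 (1 / t) \<longrightarrow> m \<le> norm (w t \<xi>)"
      proof (rule eventually_mono[OF freq[unfolded frequency_solution_def]], rule impI)
        fix \<xi> assume elim: "\<xi> \<noteq> 0 \<and>
            damped_oscillator (\<mu> * ln (1 + norm \<xi>)) (norm \<xi>) (\<lambda>t. w t \<xi>) (\<lambda>t. v t \<xi>) \<and>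
            w 0 \<xi> = fourier u0 \<xi> \<and> v 0 \<xi> = fourier u1 \<xi>" "\<xi> \<in> cball 0 (1 / t)"
        then have xi: "norm \<xi> > 0" and osc: "damped_oscillator (\<mu> * ln (1 + norm \<xi>)) (norm \<xi>) (\<lambda>t. w t \<xi>) (\<lambda>t. v t \<xi>)"
          and w0: "w 0 \<xi> = fourier u0 \<xi>" and v0: "v 0 \<xi> = fourier u1 \<xi>" and le: "norm \<xi> \<le> 1 / t" by auto
        have xit: "norm \<xi> * t \<le> 1" using le t by (simp add: field_simps)
        have "exp (- \<mu>) * t * norm (v 0 \<xi>) - C * norm (w 0 \<xi>) \<le> norm (w t \<xi>)"
          unfolding C_def using low_frequency_bounds(2)[OF mu osc xi] le td t xit by (simp add: \<delta>_def)
        moreover have "C * norm (w 0 \<xi>) \<le> C * N0"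
          unfolding w0 N0_def norm_L1_def by (intro mult_left_mono norm_fourier_le C)
        moreover have "exp (- \<mu>) * t * cmod P - N1 \<le> exp (- \<mu>) * t * norm (v 0 \<xi>)"
        proof -
          have "cmod P - norm (v 0 \<xi>) \<le> norm \<xi> * N1"
            using norm_fourier_minus_integral_le[OF u1, of \<xi>] norm_triangle_ineq3[of "v 0 \<xi>" P]
            unfolding v0 P_def[symmetric] N1_def[symmetric] by linarith
          then have "t * (cmod P - norm (v 0 \<xi>)) \<le> t * (norm \<xi> * N1)" using t by (intro mult_left_mono) auto
          also have "\<dots> = (norm \<xi> * t) * N1" by simp
          also have "\<dots> \<le> 1 * N1" using xit N by (intro mult_right_mono) auto
          finally have "exp (- \<mu>) * (t * (cmod P - norm (v 0 \<xi>))) \<le> exp (- \<mu>) * N1" by (intro mult_left_mono) auto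
          also have "\<dots> \<le> 1 * N1" using mu N by (intro mult_right_mono) auto
          finally show ?thesis by (simp add: algebra_simps)
        qed
        moreover have "exp (- \<mu>) * t * cmod P = 2 * m" by (simp add: m_def)
        ultimately show "m \<le> norm (w t \<xi>)" using tR unfolding m_def[symmetric] R_def by linarith
      qed
      have L2: "u t \<in> L2_space" "w t \<in> L2_space"
        using F(1)[of t] t by (auto simp: has_L2_fourier_def)
      note [measurable] = L2_space_sq_norm(1)[OF L2(2)]
      have "ennreal (m\<^sup>2 * (\<beta> * (1 / t) ^ ?n)) = (\<integral>\<^sup>+\<xi>. ennreal (m\<^sup>2) * indicator (cball 0 (1 / t)) \<xi> \<partial>(lborel :: 'a measure))"
        using t beta by (subst nn_integral_cmult_indicator) (simp_all add: emeasure_cball \<beta>_def ennreal_mult)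
      also have "\<dots> \<le> sq_norm (w t)"
        unfolding sq_norm_def
      proof (rule nn_integral_mono_AE)
        show "AE \<xi> in lborel. ennreal (m\<^sup>2) * indicator (cball 0 (1 / t)) \<xi> \<le> ennreal ((norm (w t \<xi>))\<^sup>2)"
          using pointwise by eventually_elim (auto simp: indicator_def intro!: ennreal_leI power_mono m0)
      qed
      also have "\<dots> = ennreal (c * (norm_L2 (u t))\<^sup>2)"
        unfolding L2_space_sq_norm(3)[OF L2(2)] c_def using norm_L2_fourier[OF F(1), of t] t by simp
      finally have "m\<^sup>2 * (\<beta> * (1 / t) ^ ?n) \<le> c * (norm_L2 (u t))\<^sup>2"
        using c by (subst (asm) ennreal_le_iff) auto
      then have "m\<^sup>2 * (\<beta> / t ^ ?n) \<le> (norm_L2 (u t))\<^sup>2 * c"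
        by (simp add: power_divide mult.commute)
      then have "m\<^sup>2 * (\<beta> / t ^ ?n) / c \<le> (norm_L2 (u t))\<^sup>2"
        using c by (simp only: pos_divide_le_eq)
      moreover have "(C1 * cmod P * t powr (1 - real ?n / 2))\<^sup>2 = m\<^sup>2 * (\<beta> / t ^ ?n) / c"
        using t beta c by (simp add: C1_def m_def power_mult_distrib powr_rate_square power_divide mult_ac)
      ultimately show ?thesis by (intro power2_le_imp_le[OF _ norm_L2_nonneg]) simp
    qed simp
    then show ?thesis using t0 unfolding P_def by blast
  qed
  show ?thesis using main C1 by blast
qed

theorem theorem1p4:
  fixes \<mu> :: real
  assumes "\<mu> > 2"
  shows "\<exists>C1>0. \<exists>C2>0. \<forall>(u0 :: 'a::euclidean_space \<Rightarrow> complex) (u1 :: 'a \<Rightarrow> complex)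
             (u :: real \<Rightarrow> 'a \<Rightarrow> complex).
           u0 \<in> H1_space \<inter> L1_space \<longrightarrow> u1 \<in> L2_space \<inter> L11_space \<longrightarrow>
           mild_solution \<mu> u0 u1 u \<longrightarrow>
           (\<exists>t0>0. \<forall>t\<ge>t0.
              C1 * cmod (LINT x|lborel. u1 x) * t powr (1 - real DIM('a) / 2) \<le> norm_L2 (u t) \<and>
              norm_L2 (u t) \<le> C2 * (norm_L2 u0 + norm_L1 u0 + norm_L2 u1 + norm_L11 u1)
                * t powr (1 - real DIM('a) / 2))"
proof -
  obtain C1 where C1: "C1 > 0" and lower: "\<And>(u0 :: 'a \<Rightarrow> complex) u1 u.
     u0 \<in> L1_space \<Longrightarrow> u1 \<in> L11_space \<Longrightarrow> mild_solution \<mu> u0 u1 u \<Longrightarrow>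
     \<exists>t0>0. \<forall>t\<ge>t0. C1 * cmod (LINT x|lborel. u1 x) * t powr (1 - real DIM('a) / 2) \<le> norm_L2 (u t)"
    using mild_solution_lower_bound[OF assms, where 'a='a] by blast
  obtain C2 where C2: "C2 > 0" and upper: "\<And>(u0 :: 'a \<Rightarrow> complex) u1 u t.
     u0 \<in> L1_space \<Longrightarrow> u1 \<in> L11_space \<Longrightarrow> mild_solution \<mu> u0 u1 u \<Longrightarrow> t \<ge> 1 \<Longrightarrow>
     norm_L2 (u t) \<le> C2 * (norm_L2 u0 + norm_L1 u0 + norm_L2 u1 + norm_L11 u1) * t powr (1 - real DIM('a) / 2)"
    using mild_solution_upper_bound[OF assms, where 'a='a] by blast
  have "\<forall>(u0 :: 'a \<Rightarrow> complex) (u1 :: 'a \<Rightarrow> complex) (u :: real \<Rightarrow> 'a \<Rightarrow> complex).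
           u0 \<in> H1_space \<inter> L1_space \<longrightarrow> u1 \<in> L2_space \<inter> L11_space \<longrightarrow>
           mild_solution \<mu> u0 u1 u \<longrightarrow>
           (\<exists>t0>0. \<forall>t\<ge>t0.
              C1 * cmod (LINT x|lborel. u1 x) * t powr (1 - real DIM('a) / 2) \<le> norm_L2 (u t) \<and>
              norm_L2 (u t) \<le> C2 * (norm_L2 u0 + norm_L1 u0 + norm_L2 u1 + norm_L11 u1)
                * t powr (1 - real DIM('a) / 2))"
  proof (intro allI impI)
    fix u0 u1 :: "'a \<Rightarrow> complex" and u
    assume u0: "u0 \<in> H1_space \<inter> L1_space" and u1: "u1 \<in> L2_space \<inter> L11_space" and u: "mild_solution \<mu> u0 u1 u"
    obtain t0 where t0: "t0 > 0" "\<And>t. t \<ge> t0 \<Longrightarrow>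
        C1 * cmod (LINT x|lborel. u1 x) * t powr (1 - real DIM('a) / 2) \<le> norm_L2 (u t)"
      using lower[of u0 u1 u] u0 u1 u by auto
    show "\<exists>t0>0. \<forall>t\<ge>t0.
              C1 * cmod (LINT x|lborel. u1 x) * t powr (1 - real DIM('a) / 2) \<le> norm_L2 (u t) \<and>
              norm_L2 (u t) \<le> C2 * (norm_L2 u0 + norm_L1 u0 + norm_L2 u1 + norm_L11 u1)
                * t powr (1 - real DIM('a) / 2)"
      using t0 upper[of u0 u1 u] u0 u1 u by (intro exI[of _ "max 1 t0"]) auto
  qed
  then show ?thesis using C1 C2 by blast
qed

end
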